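(* Let $\lambda$ be a Ferrers shape and let $\mathbf a=(a_1,a_2,\dots)$ be a finite sequence of positive integers. Then $$\bigl|W^{(a_1,a_2,\dots)}_\lambda(\{231,221\})\bigr|=\bigl|W^{(a_1,a_2,\dots)}_\lambda(\{312,212\})\bigr|.$$ That is, the sets of patterns $\{231,221\}$ and $\{312,212\}$ are shape-Wilf-equivalent for words.
   Context: A Ferrers shape $\lambda=(\lambda_1,\lambda_2,\dots)$ with $\lambda_1\ge\lambda_2\ge\cdots$ is drawn in French convention: a left-justified arrangement of cells with $\lambda_i$ cells in row $i$, rows numbered from bottom (row 1) to top; columns are numbered from left to right. A $0$-$1$-filling of $\lambda$ assigns $0$ or $1$ to each cell. For a word $x=x_1x_2\cdots x_r$ over the positive integers with largest letter $M$, let $M(x)$ be the $M\times r$ $0$-$1$ matrix (rows numbered bottom to top) having a $1$ in row $x_j$ of column $j$ for each $j$, and $0$ elsewhere. A filling $F$ of $\lambda$ contains $x$ if there are rows $\rho_1<\rho_2<\dots<\rho_M$ and columns $c_1<c_2<\dots<c_r$ such that every cell (row $\rho_l$, column $c_j$) lies in $\lambda$ and the entries of $F$ in these cells form exactly the matrix $M(x)$; otherwise $F$ avoids $x$. For a set $\Omega$ of words, $W^{(a_1,a_2,\dots)}_\lambda(\Omega)$ denotes the set of $0$-$1$-fillings of $\lambda$ with exactly one $1$ in each column, exactly $a_i$ ones in row $i$ for each $i$, and which avoid every word in $\Omega$. Two sets of words $\Omega,\Sigma$ are shape-Wilf-equivalent for words if $|W^{(a_1,a_2,\dots)}_\lambda(\Omega)|=|W^{(a_1,a_2,\dots)}_\lambda(\Sigma)|$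 for all finite sequences of positive integers $a_1,a_2,\dots$ and all Ferrers shapes $\lambda$. *)

theory Defs
  imports Main
begin

text \<open>A Ferrers shape is a list lam = [lam_1, lam_2, ...] of positive, weakly decreasing row
lengths; row i (1-based, bottom to top) has lam_i cells. Cells are pairs (row, column), 1-based.\<close>

definition ferrers :: "nat list \<Rightarrow> bool" where
  "ferrers lam \<longleftrightarrow> sorted_wrt (\<ge>) lam \<and> (\<forall>k \<in> set lam. 0 < k)"

definition cells :: "nat list \<Rightarrow> (nat \<times> nat) set" where
  "cells lam = {(i, j). 1 \<le> i \<and> i \<le> length lam \<and> 1 \<le> j \<and> j \<le> lam ! (i - 1)}"

text \<open>A 0-1-filling of lam is represented by the set of its cells containing a 1
(a subset of cells lam).\<close>

definition contains_word :: "nat list \<Rightarrow> (nat \<times> nat) set \<Rightarrow> nat list \<Rightarrow> bool" where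
  "contains_word lam F x \<longleftrightarrow>
     (let M = Max (set x); r = length x in
      \<exists>\<rho> c :: nat \<Rightarrow> nat.
        strict_mono_on {1..M} \<rho> \<and> strict_mono_on {1..r} c \<and>
        (\<forall>l \<in> {1..M}. \<forall>j \<in> {1..r}. (\<rho> l, c j) \<in> cells lam \<and>
            ((\<rho> l, c j) \<in> F \<longleftrightarrow> x ! (j - 1) = l)))"

definition W :: "nat list \<Rightarrow> nat list \<Rightarrow> nat list set \<Rightarrow> (nat \<times> nat) set set" where
  "W lam a \<Omega> = {F. F \<subseteq> cells lam \<and>
     (\<forall>j. 1 \<le> j \<and> (\<exists>i. (i, j) \<in> cells lam) \<longrightarrow> card {i. (i, j) \<in> F} = 1) \<and>
     (\<forall>i. 1 \<le> i \<longrightarrow> card {j. (i, j) \<in> F} = (if i \<le> length a then a ! (i - 1) else 0)) \<and>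
     (\<forall>x \<in> \<Omega>. \<not> contains_word lam F x)}"

end

theory Submission
  imports Defs "HOL-Computational_Algebra.Polynomial" "HOL-Library.Product_Lexorder"
    "HOL-Library.Multiset"
begin

text \<open>
Read a filling that avoids 312 and 212 as the word of its columns and follow the border of the shape
from its lower right to its upper left end: an up step inserts all copies of a new largest letter into
the word restricted to the current rows, a left step deletes the last letter. Avoidance forces the
copies to be inserted contiguously into the last weakly decreasing run, so the number of completions
depends on the list of run lengths alone, and the fillings are counted by walks on compositions.
For 231 and 221 list the columns row by row, increasing in each row: this word avoids 312, its
letters are distinct, and the same walks count it, now along the reversed border with the two kinds
of step exchanged, and with ascents prescribed inside each row.

The two counts agree because on nonempty compositions every Dyck excursion acts, in either reading,
as a polynomial in the operator \<open>S\<close> that splits the first part in two. With \<open>T\<close> raising the first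
part, insertion of a letter is \<open>(1 + S) T\<close>, of a repeated letter \<open>T\<close>, while removal \<open>C\<close> satisfies
\<open>C f(S) T = f(S) + (f(S) - f(0)) / S\<close> and removal at an ascent \<open>C'\<close> satisfies
\<open>C' f(S) T = (f(S) - f(0)) / S\<close>. Hence \<open>C f(S) T = C' f(S) (1 + S) T\<close>; as polynomials in \<open>S\<close>
commute, the recursion over Dyck paths is the same in both directions.
\<close>

section \<open>Walks along the border of the shape\<close>

text \<open>A flagged row step stands for a further copy of the letter of the preceding row step.\<close>

datatype step = Row bool | Col

text \<open>States are lists of run lengths. A step acts on the function \<open>g\<close> that counts the completions from a
state: the result at \<open>\<kappa>\<close> is the sum of \<open>g\<close> over the states reachable from \<open>\<kappa>\<close>.\<close>

definition raise_op :: "(nat list \<Rightarrow> nat) \<Rightarrow> nat list \<Rightarrow> nat" where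
  "raise_op g \<kappa> = (case \<kappa> of [] \<Rightarrow> 0 | k # ks \<Rightarrow> g (Suc k # ks))"

text \<open>With j letters of the first run in front of the new largest letter, that run is cut into
  \<open>Suc j\<close> and \<open>k - j\<close>; the separate first term is the uncut case j =
  k.\<close>

definition ins_op :: "(nat list \<Rightarrow> nat) \<Rightarrow> nat list \<Rightarrow> nat" where
  "ins_op g \<kappa> = (case \<kappa> of [] \<Rightarrow> g [1]
     | k # ks \<Rightarrow> g (Suc k # ks) + (\<Sum>j<k. g (Suc j # (k - j) # ks)))"

definition rem_op :: "(nat list \<Rightarrow> nat) \<Rightarrow> nat list \<Rightarrow> nat" where
  "rem_op g \<kappa> = (case \<kappa> of [] \<Rightarrow> 0 | k # ks \<Rightarrow> if k = 0 then 0 else if k = 1 then g ks else g ((k - 1) # ks))"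

text \<open>A removed letter exceeds the newly exposed one exactly when it forms a run by itself and
  another run follows.\<close>

definition asc_rem_op :: "(nat list \<Rightarrow> nat) \<Rightarrow> nat list \<Rightarrow> nat" where
  "asc_rem_op g \<kappa> = (case \<kappa> of [] \<Rightarrow> 0 | k # ks \<Rightarrow> if k = 1 \<and> ks \<noteq> [] then g ks else 0)"

definition split_op :: "(nat list \<Rightarrow> nat) \<Rightarrow> nat list \<Rightarrow> nat" where
  "split_op g \<kappa> = (case \<kappa> of [] \<Rightarrow> 0 | k # ks \<Rightarrow> \<Sum>j=1..<k. g (j # (k - j) # ks))"

fun up_op :: "step \<Rightarrow> (nat list \<Rightarrow> nat) \<Rightarrow> nat list \<Rightarrow> nat" where
  "up_op (Row b) = (if b then raise_op else ins_op)"
| "up_op Col = rem_op"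

fun down_op :: "step \<Rightarrow> (nat list \<Rightarrow> nat) \<Rightarrow> nat list \<Rightarrow> nat" where
  "down_op (Row b) = (if b then asc_rem_op else rem_op)"
| "down_op Col = ins_op"

section \<open>Polynomials evaluated at the splitting operator by Horner's rule\<close>

definition poly_op :: "nat poly \<Rightarrow> (nat list \<Rightarrow> nat) \<Rightarrow> nat list \<Rightarrow> nat" where
  "poly_op p = fold_coeffs (\<lambda>c F g \<kappa>. c * g \<kappa> + split_op (F g) \<kappa>) p (\<lambda>g \<kappa>. 0)"

lemma rem_op_Suc [simp]: "rem_op g (Suc k # ks) = (if k = 0 then g ks else g (k # ks))"
  by (simp add: rem_op_def)

lemma asc_rem_op_Suc [simp]: "asc_rem_op g (Suc k # ks) = (if k = 0 \<and> ks \<noteq> [] then g ks else 0)"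
  by (simp add: asc_rem_op_def)

lemma split_op_zero [simp]: "split_op (\<lambda>\<kappa>. 0) \<kappa> = 0"
  by (simp add: split_op_def split: list.split)

lemma split_op_add: "split_op (\<lambda>\<kappa>. g \<kappa> + h \<kappa>) \<kappa> = split_op g \<kappa> + split_op h \<kappa>"
  by (simp add: split_op_def sum.distrib split: list.split)

lemma split_op_mult: "split_op (\<lambda>\<kappa>. c * g \<kappa>) \<kappa> = c * split_op g \<kappa>"
  by (simp add: split_op_def sum_distrib_left split: list.split)

lemma split_op_one [simp]: "split_op g (Suc 0 # ks) = 0"
  by (simp add: split_op_def)

lemma poly_op_0 [simp]: "poly_op 0 g = (\<lambda>\<kappa>. 0)"
  by (simp add: poly_op_def)

lemma poly_op_pCons [simp]: "poly_op (pCons c p) g \<kappa> = c * g \<kappa> + split_op (poly_op p g) \<kappa>"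
  by (cases "c = 0 \<and> p = 0") (auto simp: poly_op_def)

lemma poly_op_add: "poly_op (p + q) g \<kappa> = poly_op p g \<kappa> + poly_op q g \<kappa>"
proof (induction p arbitrary: q \<kappa>)
  case (pCons a p)
  obtain b q' where "q = pCons b q'" by (cases q)
  moreover have "poly_op (p + q') g = (\<lambda>\<kappa>. poly_op p g \<kappa> + poly_op q' g \<kappa>)" for q'
    using pCons by blast
  ultimately show ?case by (simp add: split_op_add distrib_right)
qed simp

lemma poly_op_smult: "poly_op (smult a p) g \<kappa> = a * poly_op p g \<kappa>"
proof (induction p arbitrary: \<kappa>)
  case (pCons b p)
  then have "poly_op (smult a p) g = (\<lambda>\<kappa>. a * poly_op p g \<kappa>)" by blast
  then show ?case by (simp add: split_op_mult algebra_simps)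
qed simp

lemma poly_op_mult: "poly_op (p * q) g \<kappa> = poly_op p (poly_op q g) \<kappa>"
proof (induction p arbitrary: \<kappa>)
  case (pCons b p)
  then have "poly_op (p * q) g = poly_op p (poly_op q g)" by blast
  then show ?case by (simp add: poly_op_add poly_op_smult)
qed simp

text \<open>Splitting produces only positive first parts, so the values at other states never
  enter.\<close>

lemma poly_op_cong:
  assumes "\<And>k ks. k > 0 \<Longrightarrow> g (k # ks) = h (k # ks)" and "k > 0"
  shows "poly_op p g (k # ks) = poly_op p h (k # ks)"
  using assms(2)
proof (induction p arbitrary: k ks)
  case (pCons c p)
  then show ?case using assms(1) by (simp add: split_op_def)
qed simp

text \<open>An insertion raises the first part and then either keeps it whole or splits it: this is
  (1 + S) T.\<close>

lemma ins_op_Cons: "ins_op g (k # ks) = poly_op [:1, 1:] g (Suc k # ks)"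
proof -
  have "(\<Sum>j<k. g (Suc j # (k - j) # ks)) = (\<Sum>j=1..<Suc k. g (j # (Suc k - j) # ks))"
    using sum.shift_bounds_Suc_ivl[of "\<lambda>j. g (j # (Suc k - j) # ks)" 0 k]
    by (simp add: atLeast0LessThan)
  moreover have "poly_op [:1:] g = g" by (rule ext) simp
  ultimately show ?thesis by (simp add: ins_op_def split_op_def one_pCons)
qed

text \<open>The split with first part 1 is isolated because a removal deletes that part; in every
  other split a removal only lowers the first part.\<close>

lemma split_op_Suc:
  assumes "k > 0"
  shows "split_op g (Suc k # ks) = g (1 # k # ks) + (\<Sum>j=1..<k. g (Suc j # (k - j) # ks))"
proof -
  have "split_op g (Suc k # ks) = (\<Sum>j=0..<k. g (Suc j # (k - j) # ks))"
    using sum.shift_bounds_Suc_ivl[of "\<lambda>j. g (j # (Suc k - j) # ks)" 0 k]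
    by (simp add: split_op_def)
  then show ?thesis using assms by (simp add: sum.atLeast_Suc_lessThan)
qed

text \<open>This is C f(S) T = f(S) + (f(S) - f(0)) / S for f = c + X p, where the quotient is p.
  The extra p comes from the splits with first part 1, which the removal deletes.\<close>

lemma poly_op_rem_op:
  assumes "k > 0"
  shows "poly_op (pCons c p) (rem_op g) (Suc k # ks) = poly_op (pCons c p + p) g (k # ks)"
  using assms
proof (induction p arbitrary: c k ks)
  case 0
  then show ?case by simp
next
  case (pCons b p)
  have "split_op (poly_op (pCons b p) (rem_op g)) (Suc k # ks)
      = poly_op (pCons b p) (rem_op g) (1 # k # ks)
        + (\<Sum>j=1..<k. poly_op (pCons b p) (rem_op g) (Suc j # (k - j) # ks))"
    using pCons.prems by (rule split_op_Suc)
  \<comment> \<open>The part 1 cannot be split again, so only the constant b survives there; the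
    other summands are instances of the induction hypothesis.\<close>
  also have "\<dots> = b * g (k # ks) + (\<Sum>j=1..<k. poly_op (pCons b p + p) g (j # (k - j) # ks))"
    using pCons.prems
    by (intro arg_cong2[of _ _ _ _ "(+)"] sum.cong refl pCons.IH) simp_all
  also have "\<dots> = b * g (k # ks) + split_op (poly_op (pCons b p + p) g) (k # ks)"
    by (simp add: split_op_def)
  also have "poly_op (pCons b p + p) g = (\<lambda>\<kappa>. poly_op (pCons b p) g \<kappa> + poly_op p g \<kappa>)"
    by (rule ext) (rule poly_op_add)
  finally show ?case
    using pCons.prems unfolding poly_op_add poly_op_pCons[of c]
    by (simp add: split_op_add poly_op_pCons[of b p g "k # ks"] del: poly_op_pCons)
qed

text \<open>The same computation for C': removal at an ascent needs a first part 1, so the summand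
  f(S) is lost and only the quotient p remains.\<close>

lemma poly_op_asc_rem_op:
  assumes "k > 0"
  shows "poly_op (pCons c p) (asc_rem_op g) (Suc k # ks) = poly_op p g (k # ks)"
  using assms
proof (induction p arbitrary: c k ks)
  case 0
  then show ?case by simp
next
  case (pCons b p)
  have "split_op (poly_op (pCons b p) (asc_rem_op g)) (Suc k # ks)
      = poly_op (pCons b p) (asc_rem_op g) (1 # k # ks)
        + (\<Sum>j=1..<k. poly_op (pCons b p) (asc_rem_op g) (Suc j # (k - j) # ks))"
    using pCons.prems by (rule split_op_Suc)
  also have "\<dots> = b * g (k # ks) + (\<Sum>j=1..<k. poly_op p g (j # (k - j) # ks))"
    using pCons.prems
    by (intro arg_cong2[of _ _ _ _ "(+)"] sum.cong refl pCons.IH) simp_all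
  finally show ?case
    using pCons.prems unfolding poly_op_pCons[of c]
    by (simp add: split_op_def del: poly_op_pCons) (simp add: split_op_def)
qed

section \<open>Dyck paths as operators on states\<close>

inductive dyck :: "step list \<Rightarrow> bool" where
  dyck_Nil: "dyck []"
| dyck_Row: "dyck P \<Longrightarrow> dyck Q \<Longrightarrow> dyck (Row b # P @ Col # Q)"

lemma poly_op_single [simp]: "poly_op p g [Suc 0] = coeff p 0 * g [Suc 0]"
  by (cases p) simp

text \<open>The operators act on counting functions, so \<open>foldr\<close> walks from the first
  step of the path and \<open>fold\<close> from the last. Both readings give the same polynomial for
  each arch, and reversing the order of the arches is harmless because polynomials commute.\<close>

lemma dyck_poly_op:
  assumes "dyck P"
  shows "\<exists>p. \<forall>g k ks. k > 0 \<longrightarrow> foldr up_op P g (k # ks) = poly_op p g (k # ks)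
               \<and> fold down_op P g (k # ks) = poly_op p g (k # ks)"
  using assms
proof induction
  case dyck_Nil
  have "poly_op 1 g \<kappa> = g \<kappa>" for g \<kappa> by (simp add: one_pCons)
  then show ?case by (intro exI[of _ 1]) simp
next
  case (dyck_Row P Q b)
  obtain p where p: "foldr up_op P g (k # ks) = poly_op p g (k # ks)"
      "fold down_op P g (k # ks) = poly_op p g (k # ks)" if "k > 0" for g k ks
    using dyck_Row.IH(1) by blast
  obtain q where q: "foldr up_op Q g (k # ks) = poly_op q g (k # ks)"
      "fold down_op Q g (k # ks) = poly_op q g (k # ks)" if "k > 0" for g k ks
    using dyck_Row.IH(2) by blast
  obtain c p' where pc: "p = pCons c p'" by (cases p)
  \<comment> \<open>A flagged row gives p + p' in both readings: as p plus its quotient p' (raising,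
    then plain removal), and as the quotient of (1 + X) p (insertion, then removal at an ascent). An
    unflagged row gives insertion and plain removal around P either way.\<close>
  define r where "r = (if b then p + p' else pCons c (p + p') + (p + p'))"
  have "[:1, 1:] * p = p + pCons 0 p" by (simp del: One_nat_def)
  then have pp: "[:1, 1:] * p = pCons c (p + p')" by (simp add: pc add.commute)
  have ins: "ins_op (foldr up_op P g) (k # ks) = poly_op (pCons c (p + p')) g (Suc k # ks)"
    "ins_op (fold down_op P g) (k # ks) = poly_op (pCons c (p + p')) g (Suc k # ks)"
    for g k ks
    unfolding ins_op_Cons pp[symmetric] poly_op_mult
    by (rule poly_op_cong; simp add: p)+
  have up: "up_op (Row b) (foldr up_op P (rem_op g)) (k # ks) = poly_op r g (k # ks)"
    if "k > 0" for g k ks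
  proof (cases b)
    case True
    then show ?thesis using that p(1)[of "Suc k" "rem_op g" ks] poly_op_rem_op[of k c p' g ks]
      by (simp add: raise_op_def r_def pc del: poly_op_pCons)
  next
    case False
    then show ?thesis using that ins(1)[of "rem_op g"] poly_op_rem_op[of k c "p + p'" g ks]
      by (simp add: r_def)
  qed
  have down: "ins_op (fold down_op P (down_op (Row b) g)) (k # ks) = poly_op r g (k # ks)"
    if "k > 0" for g k ks
    using that ins(2)[of "down_op (Row b) g"]
      poly_op_rem_op[of k c "p + p'" g ks] poly_op_asc_rem_op[of k c "p + p'" g ks]
    by (cases b) (simp_all add: r_def)
  have "foldr up_op (Row b # P @ Col # Q) g (k # ks) = poly_op (r * q) g (k # ks)
      \<and> fold down_op (Row b # P @ Col # Q) g (k # ks) = poly_op (r * q) g (k # ks)"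
    if "k > 0" for g k ks
  proof
    have "foldr up_op (Row b # P @ Col # Q) g (k # ks) = poly_op r (foldr up_op Q g) (k # ks)"
      using up[OF that] by simp
    also have "\<dots> = poly_op (r * q) g (k # ks)"
      unfolding poly_op_mult by (rule poly_op_cong) (use q that in auto)
    finally show "foldr up_op (Row b # P @ Col # Q) g (k # ks) = poly_op (r * q) g (k # ks)" .
    have "fold down_op (Row b # P @ Col # Q) g (k # ks)
        = poly_op q (ins_op (fold down_op P (down_op (Row b) g))) (k # ks)"
      using q(2)[OF that] by simp
    \<comment> \<open>In the reversed reading Q is walked before the arch, which swaps the
      factors.\<close>
    also have "\<dots> = poly_op (q * r) g (k # ks)"
      unfolding poly_op_mult by (rule poly_op_cong) (use down that in auto)
    finally show "fold down_op (Row b # P @ Col # Q) g (k # ks) = poly_op (r * q) g (k # ks)"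
      by (simp add: mult.commute)
  qed
  then show ?case by blast
qed

text \<open>The first letter leads to the state [1], which cannot be split, so only the constant
  coefficient of the inner polynomial survives.\<close>

lemma dyck_empty_state:
  assumes "dyck P"
  shows "\<exists>n. \<forall>g. foldr up_op P g [] = n * g [] \<and> fold down_op P g [] = n * g []"
  using assms
proof induction
  case dyck_Nil
  show ?case by (intro exI[of _ 1]) simp
next
  case (dyck_Row P Q b)
  obtain p where p: "foldr up_op P g (k # ks) = poly_op p g (k # ks)"
      "fold down_op P g (k # ks) = poly_op p g (k # ks)" if "k > 0" for g k ks
    using dyck_poly_op[OF dyck_Row.hyps(1)] by blast
  obtain n where n: "foldr up_op Q g [] = n * g []" "fold down_op Q g [] = n * g []" for g
    using dyck_Row.IH(2) by blast
  \<comment> \<open>On the empty word a flagged row step has no letter to repeat, and in the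
    reversed reading no exposed letter to exceed; hence the value 0.\<close>
  define m where "m = (if b then 0 else coeff p 0)"
  have "foldr up_op (Row b # P @ Col # Q) g [] = m * n * g []" for g
    using n(1)[of g] p(1)[of 1 "rem_op (foldr up_op Q g)" "[]"]
    by (simp add: m_def raise_op_def ins_op_def rem_op_def)
  moreover have "fold down_op (Row b # P @ Col # Q) g [] = m * n * g []" for g
    using n(2) p(2)[of 1 "asc_rem_op g" "[]"] p(2)[of 1 "rem_op g" "[]"]
    by (simp add: m_def ins_op_def rem_op_def asc_rem_op_def)
  ultimately show ?case by blast
qed

section \<open>Walks that are not Dyck paths\<close>

fun leads :: "nat \<Rightarrow> step list \<Rightarrow> nat \<Rightarrow> bool" where
  "leads h [] s \<longleftrightarrow> h = s"
| "leads h (Row b # Q) s \<longleftrightarrow> leads (Suc h) Q s"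
| "leads h (Col # Q) s \<longleftrightarrow> h > 0 \<and> leads (h - 1) Q s"

text \<open>A path that starts above 0 is cut at its first step below the starting height; what
  precedes that step is a Dyck path.\<close>

lemma leads_dyck:
  "leads h Q 0 \<Longrightarrow> if h = 0 then dyck Q else \<exists>P Q'. Q = P @ Col # Q' \<and> dyck P \<and> leads (h - 1) Q' 0"
proof (induction "length Q" arbitrary: h Q rule: less_induct)
  case less
  show ?case
  proof (cases Q)
    case Nil
    with less.prems show ?thesis by (simp add: dyck_Nil)
  next
    case (Cons s Q1)
    show ?thesis
    proof (cases s)
      case Col
      with less.prems Cons have "h > 0" "leads (h - 1) Q1 0" by auto
      moreover have "Q = [] @ Col # Q1" using Cons Col by simp
      ultimately show ?thesis using dyck_Nil by (metis less_irrefl)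
    next
      case (Row b)
      then have "leads (Suc h) Q1 0" "length Q1 < length Q" using less.prems Cons by auto
      with less.hyps[of Q1 "Suc h"] obtain P Q2
        where P: "Q1 = P @ Col # Q2" "dyck P" "leads h Q2 0" by auto
      then have "length Q2 < length Q" using Cons by simp
      with less.hyps[of Q2 h] P(3) have *: "if h = 0 then dyck Q2
          else \<exists>P Q'. Q2 = P @ Col # Q' \<and> dyck P \<and> leads (h - 1) Q' 0"
        by blast
      show ?thesis
      proof (cases "h = 0")
        case True
        with * P Cons Row dyck_Row show ?thesis by auto
      next
        case False
        with * obtain P' Q' where P': "Q2 = P' @ Col # Q'" "dyck P'" "leads (h - 1) Q' 0" by auto
        have "Q = (Row b # P @ Col # P') @ Col # Q'" using Cons Row P P' by simp
        with dyck_Row[OF P(2) P'(2)] P'(3) False show ?thesis by metis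
      qed
    qed
  qed
qed

lemma leads_unique: "leads h Q s \<Longrightarrow> leads h' Q s \<Longrightarrow> h = h'"
  by (induction h Q s arbitrary: h' rule: leads.induct) (auto, (metis leads.simps One_nat_def Suc_pred)+)

definition empty_state :: "nat list \<Rightarrow> nat" where
  "empty_state \<kappa> = (if \<kappa> = [] then 1 else 0)"

text \<open>The sum of a state is the length of the word, and each step changes it by one; this
  lemma and the next three follow that sum along a walk.\<close>

lemma ins_op_nonzero:
  assumes "ins_op g \<kappa> \<noteq> 0"
  shows "\<exists>\<kappa>'. g \<kappa>' \<noteq> 0 \<and> sum_list \<kappa>' = Suc (sum_list \<kappa>)"
proof (cases \<kappa>)
  case Nil
  with assms show ?thesis by (intro exI[of _ "[1]"]) (simp add: ins_op_def)
next
  case (Cons k ks)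
  show ?thesis
  proof (cases "g (Suc k # ks) = 0")
    case True
    with assms Cons have "(\<Sum>j<k. g (Suc j # (k - j) # ks)) \<noteq> 0"
      by (simp add: ins_op_def)
    then obtain j where "j < k" "g (Suc j # (k - j) # ks) \<noteq> 0"
      by (meson lessThan_iff sum.neutral)
    then show ?thesis using Cons by (intro exI[of _ "Suc j # (k - j) # ks"]) simp
  qed (use Cons in \<open>auto intro!: exI[of _ "Suc k # ks"]\<close>)
qed

lemma rem_op_nonzero:
  assumes "rem_op g \<kappa> \<noteq> 0"
  shows "\<exists>\<kappa>'. g \<kappa>' \<noteq> 0 \<and> Suc (sum_list \<kappa>') = sum_list \<kappa>"
proof (cases \<kappa>)
  case (Cons k ks)
  with assms show ?thesis
    by (cases k; cases "k = 1")
      (auto simp: rem_op_def intro: exI[of _ ks] exI[of _ "(k - 1) # ks"])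
qed (use assms in \<open>simp add: rem_op_def\<close>)

lemma up_op_nonzero:
  assumes "up_op t g \<kappa> \<noteq> 0"
  shows "\<exists>\<kappa>'. g \<kappa>' \<noteq> 0 \<and> (if t = Col then Suc (sum_list \<kappa>') = sum_list \<kappa>
           else sum_list \<kappa>' = Suc (sum_list \<kappa>))"
proof (cases t)
  case (Row b)
  have "ins_op g \<kappa> \<noteq> 0"
    using assms Row by (auto simp: ins_op_def raise_op_def split: if_splits list.splits)
  from ins_op_nonzero[OF this] Row show ?thesis by simp
qed (use assms rem_op_nonzero in auto)

lemma down_op_nonzero:
  assumes "down_op t g \<kappa> \<noteq> 0"
  shows "\<exists>\<kappa>'. g \<kappa>' \<noteq> 0 \<and> (if t = Col then sum_list \<kappa>' = Suc (sum_list \<kappa>)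
           else Suc (sum_list \<kappa>') = sum_list \<kappa>)"
proof (cases t)
  case (Row b)
  have "rem_op g \<kappa> \<noteq> 0"
    using assms Row by (auto simp: rem_op_def asc_rem_op_def split: if_splits list.splits)
  from rem_op_nonzero[OF this] Row show ?thesis by simp
qed (use assms ins_op_nonzero in auto)

lemma foldr_up_op_leads:
  assumes "\<And>\<kappa>. g \<kappa> \<noteq> 0 \<Longrightarrow> sum_list \<kappa> = s" and "foldr up_op Q g \<kappa> \<noteq> 0"
  shows "leads (sum_list \<kappa>) Q s"
  using assms(2)
proof (induction Q arbitrary: \<kappa>)
  case (Cons t Q)
  from up_op_nonzero[of t "foldr up_op Q g" \<kappa>] Cons.prems obtain \<kappa>'
    where "foldr up_op Q g \<kappa>' \<noteq> 0" and *: "if t = Col then Suc (sum_list \<kappa>') = sum_list \<kappa>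
           else sum_list \<kappa>' = Suc (sum_list \<kappa>)" by auto
  with Cons.IH have "leads (sum_list \<kappa>') Q s" by blast
  with * show ?case by (cases t) (auto simp flip: * split: if_splits)
qed (use assms in simp)

text \<open>Here the steps act on g one after the other, so the induction generalises over g and
  over the size h of the states in its support.\<close>

lemma fold_down_op_leads:
  assumes "\<And>\<kappa>. g \<kappa> \<noteq> 0 \<Longrightarrow> sum_list \<kappa> = h" and "fold down_op Q g \<kappa> \<noteq> 0"
  shows "leads h Q (sum_list \<kappa>)"
  using assms
proof (induction Q arbitrary: g h)
  case (Cons t Q)
  have supp: "if t = Col then h = Suc (sum_list \<kappa>') else Suc h = sum_list \<kappa>'"
    if "down_op t g \<kappa>' \<noteq> 0" for \<kappa>'
    using down_op_nonzero[OF that] Cons.prems(1) by (auto split: if_splits)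
  have *: "leads h' Q (sum_list \<kappa>)" if "\<And>\<kappa>'. down_op t g \<kappa>' \<noteq> 0 \<Longrightarrow> sum_list \<kappa>' = h'" for h'
    using Cons.IH[of "down_op t g" h'] that Cons.prems(2) by simp
  show ?case
  proof (cases t)
    case (Row b)
    with supp * show ?thesis by fastforce
  next
    case Col
    have "leads (h - 1) Q (sum_list \<kappa>)"
      using supp Col by (intro *) fastforce
    moreover have "h > 0"
    proof (rule ccontr)
      assume "\<not> h > 0"
      with supp Col have z: "down_op t g \<kappa>' = 0" for \<kappa>' by force
      \<comment> \<open>The zero function is supported on states of any chosen size, so the
        induction hypothesis yields two starting heights for the same path and end.\<close>
      have "leads 1 Q (sum_list \<kappa>)" "leads 2 Q (sum_list \<kappa>)"
        by (intro *; use z in force)+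
      then show False using leads_unique by fastforce
    qed
    ultimately show ?thesis using Col by simp
  qed
qed simp

lemma empty_state_nonzero: "empty_state \<kappa> \<noteq> 0 \<Longrightarrow> sum_list \<kappa> = 0"
  by (simp add: empty_state_def split: if_splits)

text \<open>If the border is not a Dyck path, word lengths cannot follow it from 0 back to 0, and
  both counts vanish.\<close>

theorem up_down_walks:
  "foldr up_op Q empty_state [] = fold down_op Q empty_state []"
proof (cases "leads 0 Q 0")
  case True
  then have "dyck Q" using leads_dyck[of 0 Q] by simp
  from dyck_empty_state[OF this] show ?thesis by auto
next
  case False
  then show ?thesis
    using foldr_up_op_leads[of empty_state 0 Q "[]"] fold_down_op_leads[of empty_state 0 Q "[]"]
      empty_state_nonzero by fastforce
qed

section \<open>Words avoiding 312 and 212\<close>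

text \<open>From here on words are stored in reverse, so that the next letter to be removed is the head, and runs
are weakly increasing. \<open>Ins a\<close> inserts \<open>a\<close> copies of the next letter; \<open>Rem b\<close> removes a letter, which
for \<open>b = True\<close> has to exceed the one that is exposed. The parameter \<open>m\<close> of the functions below is the
number of insertions performed so far.\<close>

datatype event = Ins nat | Rem bool

text \<open>The number of insertions before a removal bounds the removed letter: it is the height of
  its column or, in the other reading, the length of its row.\<close>

fun heights :: "nat \<Rightarrow> event list \<Rightarrow> (nat \<times> bool) list" where
  "heights m [] = []"
| "heights m (Ins a # E) = heights (Suc m) E"
| "heights m (Rem b # E) = (m, b) # heights m E"

fun content :: "nat \<Rightarrow> event list \<Rightarrow> nat \<Rightarrow> nat" where
  "content m [] = (\<lambda>r. 0)"
| "content m (Ins a # E) = (content (Suc m) E)(Suc m := a)"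
| "content m (Rem b # E) = content m E"

text \<open>Here y stands in front of q. A forbidden b before c with b < y \<le> c reads backwards
  as c b y, an occurrence of 312 or 212 ending in y.\<close>

definition fits :: "nat \<Rightarrow> nat list \<Rightarrow> bool" where
  "fits y q \<longleftrightarrow> sorted_wrt (\<lambda>b c. b < y \<longrightarrow> c < y) q"

fun avoids :: "nat list \<Rightarrow> bool" where
  "avoids [] \<longleftrightarrow> True"
| "avoids (y # q) \<longleftrightarrow> fits y q \<and> avoids q"

text \<open>The filter keeps the letters present when y is removed, since letters above h are
  inserted only later; its head is the letter exposed by the removal.\<close>

fun good :: "nat list \<Rightarrow> (nat \<times> bool) list \<Rightarrow> bool" where
  "good [] [] \<longleftrightarrow> True"
| "good (y # x) ((h, b) # hs) \<longleftrightarrow> y \<le> h \<and> fits y (filter (\<lambda>z. z \<le> h) x) \<and>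
     (b \<longrightarrow> (case filter (\<lambda>z. z \<le> h) x of [] \<Rightarrow> False | z # _ \<Rightarrow> z < y)) \<and> good x hs"
| "good _ _ \<longleftrightarrow> False"

text \<open>Here q is the current word after m insertions, and x lists all letters that the
  remaining events E will remove, in order.\<close>

definition words :: "event list \<Rightarrow> nat \<Rightarrow> nat list \<Rightarrow> nat list set" where
  "words E m q = {x. good x (heights m E) \<and> filter (\<lambda>z. z \<le> m) x = q \<and>
     (\<forall>r>m. count_list x r = content m E r)}"

fun runs :: "nat list \<Rightarrow> nat list" where
  "runs [] = []"
| "runs [y] = [1]"
| "runs (y # z # q) = (if y \<le> z then Suc (hd (runs (z # q))) # tl (runs (z # q)) else 1 # runs (z # q))"

text \<open>The copies of a letter form one block inside the first run, so every copy after the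
  first only lengthens that run.\<close>

fun walk :: "event list \<Rightarrow> nat list \<Rightarrow> nat" where
  "walk [] = empty_state"
| "walk (Ins a # E) = (if a = 0 then walk E else ins_op ((raise_op ^^ (a - 1)) (walk E)))"
| "walk (Rem b # E) = (if b then asc_rem_op else rem_op) (walk E)"

lemma good_length: "good x hs \<Longrightarrow> length x = length hs"
  by (induction x hs rule: good.induct) auto

lemma good_bound: "good x hs \<Longrightarrow> set x \<subseteq> {..sum_list (map fst hs)}"
  by (induction x hs rule: good.induct) auto

lemma heights_ge: "h \<in> set (heights m E) \<Longrightarrow> m \<le> fst h"
  by (induction m E rule: heights.induct) auto

lemma finite_words: "finite (words E m q)"
proof (rule finite_subset)
  let ?hs = "heights m E"
  show "words E m q \<subseteq> {x. set x \<subseteq> {..sum_list (map fst ?hs)} \<and> length x = length ?hs}"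
    using good_length good_bound unfolding words_def by blast
  show "finite {x. set x \<subseteq> {..sum_list (map fst ?hs)} \<and> length x = length ?hs}"
    by (rule finite_lists_length_eq) simp
qed

lemma fits_filter: "fits y q \<Longrightarrow> fits y (filter P q)"
  unfolding fits_def by (rule sorted_wrt_filter)

lemma good_avoids:
  "good x hs \<Longrightarrow> \<forall>h\<in>set hs. m \<le> fst h \<Longrightarrow> avoids (filter (\<lambda>z. z \<le> m) x)"
proof (induction x hs rule: good.induct)
  case (2 y x h b hs)
  have "filter (\<lambda>z. z \<le> m) x = filter (\<lambda>z. z \<le> m) (filter (\<lambda>z. z \<le> h) x)"
    using 2 by (auto intro: filter_cong)
  with 2 fits_filter[of y "filter (\<lambda>z. z \<le> h) x" "\<lambda>z. z \<le> m"] show ?case by auto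
qed auto

lemma runs_eq_Nil [simp]: "runs q = [] \<longleftrightarrow> q = []"
  by (cases q rule: runs.cases) auto

lemma hd_runs_pos: "q \<noteq> [] \<Longrightarrow> hd (runs q) > 0"
  by (induction q rule: runs.induct) auto

lemma runs_Cons:
  "runs (y # q) = (case q of [] \<Rightarrow> [1]
     | z # _ \<Rightarrow> if y \<le> z then Suc (hd (runs q)) # tl (runs q) else 1 # runs q)"
  by (cases q) auto

lemma rem_op_runs: "rem_op g (runs (y # q)) = g (runs q)"
  using hd_runs_pos[of q] by (cases q) (auto simp: hd_Cons_tl[of "runs _"])

lemma asc_rem_op_runs:
  "asc_rem_op g (runs (y # q)) = (case q of [] \<Rightarrow> 0 | z # _ \<Rightarrow> if z < y then g (runs q) else 0)"
  using hd_runs_pos[of q] by (cases q) auto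

lemma walk_runs_Rem:
  "walk (Rem b # E) (runs q) = (case q of [] \<Rightarrow> 0 | y # q' \<Rightarrow>
     if b \<longrightarrow> (case q' of [] \<Rightarrow> False | z # _ \<Rightarrow> z < y) then walk E (runs q') else 0)"
proof (cases q)
  case Nil
  then show ?thesis by (simp add: rem_op_def asc_rem_op_def)
next
  case (Cons y q')
  then show ?thesis
    by (cases q') (simp_all only: walk.simps rem_op_runs asc_rem_op_runs list.case split: if_split, auto)
qed

text \<open>The removed letter is at most m, so it belongs to the current word and is the head of
  q.\<close>

lemma words_Rem:
  assumes "avoids q" and "set q \<subseteq> {..m}"
  shows "words (Rem b # E) m q = (case q of [] \<Rightarrow> {} | y # q' \<Rightarrow>
     if b \<longrightarrow> (case q' of [] \<Rightarrow> False | z # _ \<Rightarrow> z < y) then Cons y ` words E m q' else {})"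
proof (intro set_eqI iffI)
  fix x assume "x \<in> words (Rem b # E) m q"
  then have x: "good x ((m, b) # heights m E)" "filter (\<lambda>z. z \<le> m) x = q"
    "\<forall>r>m. count_list x r = content m E r" by (auto simp: words_def)
  then obtain y x' where [simp]: "x = y # x'" by (cases x) auto
  from x show "x \<in> (case q of [] \<Rightarrow> {} | y # q' \<Rightarrow>
     if b \<longrightarrow> (case q' of [] \<Rightarrow> False | z # _ \<Rightarrow> z < y) then Cons y ` words E m q' else {})"
    by (auto simp: words_def split: list.splits if_splits)
next
  fix x assume "x \<in> (case q of [] \<Rightarrow> {} | y # q' \<Rightarrow>
     if b \<longrightarrow> (case q' of [] \<Rightarrow> False | z # _ \<Rightarrow> z < y) then Cons y ` words E m q' else {})"
  with assms show "x \<in> words (Rem b # E) m q"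
    by (auto simp: words_def split: list.splits if_splits)
qed

section \<open>Inserting copies of a new largest letter\<close>

definition insertions :: "nat \<Rightarrow> nat \<Rightarrow> nat list \<Rightarrow> nat list set" where
  "insertions a m q = {q'. avoids q' \<and> filter (\<lambda>z. z \<le> m) q' = q \<and> set q' \<subseteq> {..Suc m} \<and>
     count_list q' (Suc m) = a}"

lemma count_list_filter: "P y \<Longrightarrow> count_list (filter P x) y = count_list x y"
  by (induction x) auto

text \<open>The word just after the insertion is recovered from x by restricting to letters up to
  \<open>Suc m\<close>, which also makes the union disjoint.\<close>

lemma words_Ins: "words (Ins a # E) m q = (\<Union>q'\<in>insertions a m q. words E (Suc m) q')"
proof (intro set_eqI iffI)
  fix x assume x: "x \<in> words (Ins a # E) m q"
  let ?q = "filter (\<lambda>z. z \<le> Suc m) x"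
  have "filter (\<lambda>z. z \<le> m) ?q = filter (\<lambda>z. z \<le> m) x" by (auto intro: filter_cong)
  moreover have "count_list ?q (Suc m) = count_list x (Suc m)"
    by (simp add: count_list_filter)
  moreover have "avoids ?q"
    using x heights_ge by (intro good_avoids) (auto simp: words_def)
  ultimately have "?q \<in> insertions a m q" using x by (auto simp: insertions_def words_def)
  moreover have "x \<in> words E (Suc m) ?q" using x by (auto simp: words_def)
  ultimately show "x \<in> (\<Union>q'\<in>insertions a m q. words E (Suc m) q')" by blast
next
  fix x assume "x \<in> (\<Union>q'\<in>insertions a m q. words E (Suc m) q')"
  then obtain q' where q: "q' \<in> insertions a m q" "x \<in> words E (Suc m) q'" by blast
  then have q': "filter (\<lambda>z. z \<le> Suc m) x = q'" by (simp add: words_def)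
  have "filter (\<lambda>z. z \<le> m) q' = filter (\<lambda>z. z \<le> m) x" unfolding q'[symmetric] by (auto intro: filter_cong)
  moreover have "count_list q' (Suc m) = count_list x (Suc m)"
    unfolding q'[symmetric] by (simp add: count_list_filter)
  ultimately show "x \<in> words (Ins a # E) m q"
    using q by (auto simp: words_def insertions_def)
qed

lemma insertions_0:
  assumes "avoids q" and "set q \<subseteq> {..m}"
  shows "insertions 0 m q = {q}"
proof -
  have "filter (\<lambda>z. z \<le> m) q' = q'" if "set q' \<subseteq> {..Suc m}" "count_list q' (Suc m) = 0" for q'
    using that by (intro filter_True) (auto simp: count_list_0_iff le_Suc_eq)
  then have "insertions 0 m q \<subseteq> {q}" by (auto simp: insertions_def)
  moreover have "filter (\<lambda>z. z \<le> m) q = q" "count_list q (Suc m) = 0" "set q \<subseteq> {..Suc m}"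
    using assms(2) by (auto simp: count_list_0_iff intro!: filter_True)
  then have "q \<in> insertions 0 m q" using assms(1) by (simp add: insertions_def)
  ultimately show ?thesis by blast
qed

lemma sorted_take_iff_hd_runs:
  assumes "q \<noteq> []"
  shows "j \<le> length q \<and> sorted (take j q) \<longleftrightarrow> j \<le> hd (runs q)"
  using assms
proof (induction q arbitrary: j rule: runs.induct)
  case (2 y)
  then show ?case by (cases j) auto
next
  case (3 y z q)
  show ?case
  proof (cases j)
    case (Suc i)
    have "sorted (y # take i (z # q)) \<longleftrightarrow> i = 0 \<or> y \<le> z \<and> sorted (take i (z # q))"
      by (cases i) auto
    with Suc 3 show ?thesis by auto
  qed simp
qed simp

lemma runs_replicate_append:
  assumes "set q \<subseteq> {..<r}"
  shows "runs (replicate (Suc a) r @ q) = Suc a # runs q"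
proof (induction a)
  case 0
  show ?case using assms by (cases q) auto
next
  case (Suc a)
  then show ?case by simp
qed

text \<open>All old letters are smaller, so the block ends the run that it enters; the old letters
  of that run behind the block become a part of their own.\<close>

lemma runs_insert:
  assumes "q \<noteq> []" "j \<le> hd (runs q)" "set q \<subseteq> {..<r}"
  shows "runs (take j q @ replicate (Suc a) r @ drop j q) =
    (j + Suc a) # (if j < hd (runs q) then (hd (runs q) - j) # tl (runs q) else tl (runs q))"
  using assms
proof (induction q arbitrary: j rule: runs.induct)
  case (2 y)
  then show ?case using runs_replicate_append[of "[y]" r a] runs_replicate_append[of "[]" r a]
    by (cases j) (auto simp: runs_Cons)
next
  case (3 y z q)
  show ?case
  proof (cases j)
    case 0
    then show ?thesis using runs_replicate_append[OF "3.prems"(3)] hd_runs_pos[of "y # z # q"] by simp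
  next
    case (Suc i)
    define x where "x = take i (z # q) @ replicate (Suc a) r @ drop i (z # q)"
    have x: "runs (take j (y # z # q) @ replicate (Suc a) r @ drop j (y # z # q)) = runs (y # x)"
      by (simp add: Suc x_def)
    show ?thesis
    proof (cases "y \<le> z")
      case True
      have "runs x = (i + Suc a) # (if i < hd (runs (z # q))
          then (hd (runs (z # q)) - i) # tl (runs (z # q)) else tl (runs (z # q)))"
        unfolding x_def using "3.prems" Suc True by (intro "3.IH"(1)) auto
      moreover have "x \<noteq> []" "y \<le> hd x" using True 3 Suc by (cases i; simp add: x_def)+
      then have "runs (y # x) = Suc (hd (runs x)) # tl (runs x)" by (cases x) auto
      ultimately show ?thesis unfolding x using True Suc by simp
    next
      case False
      \<comment> \<open>A descent right after y makes the first run a single letter, so j is at most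
        1.\<close>
      with 3 Suc have "i = 0" by simp
      then have "runs (y # x) = Suc (Suc a) # runs (z # q)"
        using 3 runs_replicate_append[of "z # q" r a] by (simp add: x_def)
      then show ?thesis unfolding x using False Suc \<open>i = 0\<close> by simp
    qed
  qed
qed simp

lemma avoids_append: "avoids (P @ Q) \<Longrightarrow> avoids Q"
  by (induction P) auto

lemma fits_replicate: "y \<le> r \<Longrightarrow> fits y S \<Longrightarrow> fits y (replicate n r @ S)"
  unfolding fits_def by (induction n) auto

text \<open>In the sorted prefix P no letter is followed, before the block, by a smaller one, so the
  block completes no forbidden pattern.\<close>

lemma avoids_insert:
  assumes "avoids (P @ S)" "sorted P" "set (P @ S) \<subseteq> {..<r}"
  shows "avoids (P @ replicate n r @ S)"
  using assms
proof (induction P)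
  case Nil
  have "fits r S" using Nil.prems unfolding fits_def by (induction S) auto
  then have "fits r (replicate n r @ S)" for n by (simp add: fits_replicate)
  then show ?case using Nil.prems by (induction n) auto
next
  case (Cons y P)
  have "fits y (P @ replicate n r @ S)"
    using Cons.prems fits_replicate[of y r S n]
    by (auto simp: fits_def sorted_wrt_append[of _ P])
  with Cons show ?case by auto
qed

text \<open>A descent y, b in P together with r would read backwards as r b y, an occurrence of
  312.\<close>

lemma avoids_sorted:
  assumes "avoids (P @ r # S)" "set P \<subseteq> {..<r}"
  shows "sorted P"
  using assms
proof (induction P)
  case (Cons y P)
  then have "\<forall>b\<in>set P. b < y \<longrightarrow> r < y" by (auto simp: fits_def sorted_wrt_append)
  with Cons show ?case by fastforce
qed simp

text \<open>A smaller letter between two copies of r would give 212, so the copies of r stand at the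
  front of S.\<close>

lemma fits_max:
  assumes "fits r S" "set S \<subseteq> {..r}"
  shows "\<exists>n S'. S = replicate n r @ S' \<and> set S' \<subseteq> {..<r}"
  using assms
proof (induction S)
  case (Cons y S)
  show ?case
  proof (cases "y = r")
    case True
    with Cons obtain n S' where "S = replicate n r @ S'" "set S' \<subseteq> {..<r}"
      by (auto simp: fits_def)
    with True show ?thesis by (intro exI[of _ "Suc n"] exI[of _ S']) simp
  next
    case False
    with Cons.prems show ?thesis
      by (intro exI[of _ 0] exI[of _ "y # S"]) (auto simp: fits_def)
  qed
qed simp

text \<open>The copies form one block by \<open>fits_max\<close> and the letters in front of it are
  sorted by \<open>avoids_sorted\<close>; \<open>avoids_insert\<close> gives the converse.\<close>

lemma insertions_Suc:
  assumes "avoids q" and "set q \<subseteq> {..m}"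
  shows "insertions (Suc a) m q =
    (\<lambda>j. take j q @ replicate (Suc a) (Suc m) @ drop j q) ` {j. j \<le> length q \<and> sorted (take j q)}"
    (is "_ = ?f ` ?J")
proof (intro equalityI subsetI)
  fix x assume x: "x \<in> insertions (Suc a) m q"
  then have xs: "set x \<subseteq> {..Suc m}" "avoids x" "filter (\<lambda>z. z \<le> m) x = q"
    "count_list x (Suc m) = Suc a" by (auto simp: insertions_def)
  then have "Suc m \<in> set x" using count_list_0_iff[of x "Suc m"] by simp
  then obtain P D where D: "x = P @ Suc m # D" "Suc m \<notin> set P"
    using split_list_first by metis
  with xs have P: "set P \<subseteq> {..<Suc m}" "sorted P"
    using avoids_sorted[of P "Suc m" D] by (auto simp: subset_iff less_le)
  have "avoids (Suc m # D)" using avoids_append xs(2) D by blast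
  then obtain n S where S: "D = replicate n (Suc m) @ S" "set S \<subseteq> {..<Suc m}"
    using fits_max[of "Suc m" D] xs(1) D by auto
  have "count_list (replicate n (Suc m)) (Suc m) = n" by (induction n) auto
  moreover have "count_list S (Suc m) = 0" "count_list P (Suc m) = 0"
    using S D by (auto simp: count_list_0_iff)
  ultimately have "n = a" using xs(4) D S by simp
  have "filter (\<lambda>z. z \<le> m) P = P" "filter (\<lambda>z. z \<le> m) S = S"
    using P S by (auto intro!: filter_True)
  then have "q = P @ S" using xs(3) D S by simp
  with D S \<open>n = a\<close> P show "x \<in> ?f ` ?J"
    by (intro image_eqI[of _ _ "length P"]) auto
next
  fix x assume "x \<in> ?f ` ?J"
  then obtain j where j: "sorted (take j q)" "x = ?f j" by blast
  have "filter (\<lambda>z. z \<le> m) (take j q) = take j q" "filter (\<lambda>z. z \<le> m) (drop j q) = drop j q"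
    using assms(2) set_take_subset[of j q] set_drop_subset[of j q] by (auto intro!: filter_True)
  then have "filter (\<lambda>z. z \<le> m) x = q" using j by simp
  moreover have "count_list (take j q) (Suc m) = 0" "count_list (drop j q) (Suc m) = 0"
    using assms(2) set_take_subset[of j q] set_drop_subset[of j q] by (force simp: count_list_0_iff)+
  then have "count_list x (Suc m) = Suc a"
  proof -
    have "count_list (replicate n (Suc m)) (Suc m) = n" for n by (induction n) auto
    then show ?thesis
      using \<open>count_list (take j q) (Suc m) = 0\<close> \<open>count_list (drop j q) (Suc m) = 0\<close> j by simp
  qed
  moreover have "avoids x"
    unfolding j using assms j(1) by (intro avoids_insert) auto
  moreover have "set x \<subseteq> {..Suc m}"
    using assms(2) set_take_subset[of j q] set_drop_subset[of j q] by (auto simp: j(2))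
  ultimately show "x \<in> insertions (Suc a) m q" by (simp add: insertions_def)
qed

lemma inj_insert:
  assumes "set q \<subseteq> {..m}"
  shows "inj_on (\<lambda>j. take j q @ replicate (Suc a) (Suc m) @ drop j q) {..length q}"
\<comment> \<open>The position is recovered as the number of old letters in front of the first new
  one.\<close>
proof (rule inj_on_inverseI[where g = "\<lambda>x. length (takeWhile (\<lambda>z. z \<le> m) x)"])
  fix j assume "j \<in> {..length q}"
  moreover have "takeWhile (\<lambda>z. z \<le> m) (take j q @ Suc m # ys) = take j q" for ys
    using assms set_take_subset[of j q] by (subst takeWhile_append2) auto
  ultimately show "length (takeWhile (\<lambda>z. z \<le> m) (take j q @ replicate (Suc a) (Suc m) @ drop j q)) = j"
    by simp
qed

lemma funpow_raise_op: "(raise_op ^^ a) g (k # ks) = g ((k + a) # ks)"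
  by (induction a arbitrary: k) (auto simp: raise_op_def)

lemma sum_insertions:
  assumes "avoids q" and "set q \<subseteq> {..m}"
  shows "(\<Sum>q'\<in>insertions a m q. walk E (runs q')) = walk (Ins a # E) (runs q)"
proof (cases a)
  case 0
  with assms show ?thesis by (simp add: insertions_0)
next
  case (Suc b)
  show ?thesis
  proof (cases "q = []")
    case True
    have "runs (replicate (Suc b) r) = [Suc b]" for r
      by (induction b) auto
    moreover have "insertions a m q = {replicate (Suc b) (Suc m)}"
      using insertions_Suc[OF assms, of b] True Suc by auto
    ultimately show ?thesis using True Suc
      by (simp add: ins_op_def funpow_raise_op)
  next
    case False
    obtain k ks where k: "runs q = k # ks" using False by (cases "runs q") auto
    let ?f = "\<lambda>j. take j q @ replicate (Suc b) (Suc m) @ drop j q"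
    have J: "{j. j \<le> length q \<and> sorted (take j q)} = {..k}"
      using sorted_take_iff_hd_runs[OF False] k by auto
    have "(\<Sum>q'\<in>insertions a m q. walk E (runs q')) = (\<Sum>j\<le>k. walk E (runs (?f j)))"
      unfolding Suc insertions_Suc[OF assms] J
      using inj_on_subset[OF inj_insert[OF assms(2), of b]] J
      by (subst sum.reindex) (auto simp: o_def)
    also have "\<dots> = (\<Sum>j\<le>k. walk E ((j + Suc b) # (if j < k then (k - j) # ks else ks)))"
    proof (intro sum.cong refl arg_cong[where f = "walk E"])
      fix j assume "j \<in> {..k}"
      moreover have "set q \<subseteq> {..<Suc m}" using assms(2) by auto
      ultimately show "runs (?f j) = (j + Suc b) # (if j < k then (k - j) # ks else ks)"
        using runs_insert[OF False, of j "Suc m" b] k by simp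
    qed
    also have "\<dots> = walk E ((k + Suc b) # ks) + (\<Sum>j<k. walk E ((j + Suc b) # (k - j) # ks))"
      by (simp flip: lessThan_Suc_atMost)
    finally show ?thesis using Suc k by (simp add: ins_op_def funpow_raise_op)
  qed
qed

text \<open>A removal leaves no choice of letter, and the possible insertions are determined by the
  first run, so only the run lengths of q matter.\<close>

theorem card_words:
  "avoids q \<Longrightarrow> set q \<subseteq> {..m} \<Longrightarrow> card (words E m q) = walk E (runs q)"
proof (induction E arbitrary: m q)
  case Nil
  have "x \<in> words [] m q \<longleftrightarrow> x = [] \<and> q = []" for x
    using good_length[of x "[]"] unfolding words_def by (cases q) auto
  then have "words [] m q = (if q = [] then {[]} else {})" by auto
  then show ?case by (simp add: empty_state_def)
next
  case (Cons e E)
  show ?case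
  proof (cases e)
    case (Rem b)
    have "card (Cons y ` A) = card A" for y :: nat and A by (intro card_image) auto
    moreover have "card (words E m q') = walk E (runs q')" if "q = y # q'" for y q'
      using Cons that by auto
    ultimately show ?thesis
      unfolding Rem walk_runs_Rem words_Rem[OF Cons.prems] by (cases q) simp_all
  next
    case (Ins a)
    have fin: "finite (insertions a m q)"
      using Cons.prems by (cases a) (auto simp: insertions_0 insertions_Suc)
    have "card (words (Ins a # E) m q) = (\<Sum>q'\<in>insertions a m q. card (words E (Suc m) q'))"
      unfolding words_Ins using fin
      by (intro card_UN_disjoint) (auto simp: finite_words, auto simp: words_def)
    also have "\<dots> = (\<Sum>q'\<in>insertions a m q. walk E (runs q'))"
      using Cons.IH by (intro sum.cong) (auto simp: insertions_def)
    finally show ?thesis using sum_insertions[OF Cons.prems] Ins by simp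
  qed
qed

section \<open>Placements as sorted lists\<close>

text \<open>In a sorted list equal labels are adjacent; the flag makes their entries strictly
  decrease, so that each set of pairs is listed in only one way.\<close>

fun marks :: "(nat \<Rightarrow> nat) \<Rightarrow> nat list \<Rightarrow> (nat \<times> bool) list" where
  "marks H [] = []"
| "marks H [p] = [(H p, False)]"
| "marks H (p # p' # ps) = (H p, p = p') # marks H (p' # ps)"

text \<open>The bound by \<open>H (fst w)\<close> says that the upper right corner of the occurrence
  lies in the shape.\<close>

definition pattern_free :: "(nat \<Rightarrow> nat) \<Rightarrow> (nat \<times> nat) set \<Rightarrow> bool" where
  "pattern_free H G \<longleftrightarrow> (\<forall>u\<in>G. \<forall>v\<in>G. \<forall>w\<in>G. u < v \<longrightarrow> v < w \<longrightarrow>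
     \<not> (snd v < snd w \<and> snd w \<le> snd u \<and> snd u \<le> H (fst w)))"

text \<open>For 231 and 221 a pair in \<open>G\<close> is (row, column), for 312 and 212 it is (column, row). Both pairs of
patterns then become the same condition on triples in lexicographic order.\<close>

definition placements :: "(nat \<Rightarrow> nat) \<Rightarrow> nat list \<Rightarrow> (nat \<Rightarrow> nat) \<Rightarrow> (nat \<times> nat) set set" where
  "placements H labs c = {G. finite G \<and> (\<forall>p. card {y. (p, y) \<in> G} = count_list labs p) \<and>
     (\<forall>(p, y)\<in>G. y \<le> H p) \<and> (\<forall>y. card {p. (p, y) \<in> G} = (if y = 0 then 0 else c y)) \<and>
     pattern_free H G}"

lemma marks_Cons: "marks H (p # ps) = (H p, ps \<noteq> [] \<and> hd ps = p) # marks H ps"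
  by (cases ps) auto

lemma sorted_wrt_desc:
  fixes L :: "'a::linorder list"
  assumes "sorted_wrt (>) L"
  shows "sorted_wrt R L \<longleftrightarrow> (\<forall>u\<in>set L. \<forall>v\<in>set L. v < u \<longrightarrow> R u v)"
  using assms by (induction L) (auto dest: less_asym)

text \<open>Being the largest pair, w can only be the third member of a forbidden triple.\<close>

lemma pattern_free_insert:
  assumes "\<forall>e\<in>G. e < w"
  shows "pattern_free H (insert w G) \<longleftrightarrow> pattern_free H G \<and>
    (\<forall>u\<in>G. \<forall>v\<in>G. u < v \<longrightarrow> \<not> (snd v < snd w \<and> snd w \<le> snd u \<and> snd u \<le> H (fst w)))"
proof -
  have "\<not> w < u" if "u \<in> insert w G" for u
    using assms that by (auto dest: less_asym)
  then show ?thesis unfolding pattern_free_def using assms by blast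
qed

text \<open>Each new front pair is the largest so far: the flag secures strictness, and
  \<open>fits\<close> excludes the forbidden triples ending in the new pair.\<close>

lemma good_marks:
  assumes "length labs = length x" and "sorted_wrt (\<ge>) labs"
  shows "good x (marks H labs) \<longleftrightarrow> sorted_wrt (>) (zip labs x) \<and>
    (\<forall>(p, y)\<in>set (zip labs x). y \<le> H p) \<and> pattern_free H (set (zip labs x))"
  using assms
proof (induction labs x rule: list_induct2)
  case Nil
  then show ?case by (simp add: pattern_free_def)
next
  case (Cons p labs y x)
  let ?L = "zip labs x" and ?P = "\<lambda>z. z \<le> H p"
  define rest where "rest \<longleftrightarrow> sorted_wrt (>) ?L \<and> (\<forall>(p, y)\<in>set ?L. y \<le> H p) \<and> pattern_free H (set ?L)"
  define b where "b \<longleftrightarrow> labs \<noteq> [] \<and> hd labs = p"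
  have IH: "good x (marks H labs) \<longleftrightarrow> rest" using Cons unfolding rest_def by auto
  have good: "good (y # x) (marks H (p # labs)) \<longleftrightarrow> y \<le> H p \<and> fits y (filter ?P x) \<and>
     (b \<longrightarrow> (case filter ?P x of [] \<Rightarrow> False | z # _ \<Rightarrow> z < y)) \<and> rest"
    by (simp add: marks_Cons b_def IH)
  \<comment> \<open>Under an equal label the next letter is itself at most \<open>H p\<close>, so
    the filter does not hide it from the flag; under a smaller label the order is automatic.\<close>
  have above: "(b \<longrightarrow> (case filter ?P x of [] \<Rightarrow> False | z # _ \<Rightarrow> z < y)) \<longleftrightarrow> (\<forall>e\<in>set ?L. e < (p, y))"
    if rest
  proof (cases labs)
    case Nil
    then show ?thesis by (simp add: b_def)
  next
    case (Cons p' labs')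
    with \<open>length labs = length x\<close> obtain y' x' where x: "x = y' # x'" by (cases x) auto
    have p': "p' \<le> p" using \<open>sorted_wrt (\<ge>) (p # labs)\<close> Cons by simp
    have "y' \<le> H p'" and le: "\<forall>e\<in>set ?L. e \<le> (p', y')"
      using that Cons x unfolding rest_def by (auto simp: less_imp_le)
    then have "(b \<longrightarrow> (case filter ?P x of [] \<Rightarrow> False | z # _ \<Rightarrow> z < y)) \<longleftrightarrow> (p', y') < (p, y)"
      using p' Cons x by (cases "p' = p") (auto simp: b_def)
    also have "\<dots> \<longleftrightarrow> (\<forall>e\<in>set ?L. e < (p, y))"
    proof
      assume "(p', y') < (p, y)"
      with le show "\<forall>e\<in>set ?L. e < (p, y)" using le_less_trans by blast
    qed (simp add: Cons x)
    finally show ?thesis .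
  qed
  have fits: "fits y (filter ?P x) \<longleftrightarrow>
      (\<forall>u\<in>set ?L. \<forall>v\<in>set ?L. u < v \<longrightarrow> \<not> (snd v < y \<and> y \<le> snd u \<and> snd u \<le> H p))"
    if rest "y \<le> H p"
  proof -
    have "x = map snd ?L" using Cons.hyps by simp
    then have "filter ?P x = map snd (filter (?P \<circ> snd) ?L)" by (metis filter_map)
    then have "fits y (filter ?P x) \<longleftrightarrow> sorted_wrt (\<lambda>u v. snd u < y \<longrightarrow> snd v < y) (filter (?P \<circ> snd) ?L)"
      by (simp add: fits_def sorted_wrt_map)
    \<comment> \<open>The list decreases strictly, so its order of positions is the reverse of the
      lexicographic order of pairs.\<close>
    also have "\<dots> \<longleftrightarrow> (\<forall>v\<in>set (filter (?P \<circ> snd) ?L). \<forall>u\<in>set (filter (?P \<circ> snd) ?L).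
        u < v \<longrightarrow> snd v < y \<longrightarrow> snd u < y)"
      using that by (intro sorted_wrt_desc sorted_wrt_filter) (simp add: rest_def)
    also have "\<dots> \<longleftrightarrow> (\<forall>u\<in>set ?L. \<forall>v\<in>set ?L. snd v \<le> H p \<longrightarrow> snd u \<le> H p \<longrightarrow>
        u < v \<longrightarrow> snd v < y \<longrightarrow> snd u < y)"
      unfolding set_filter comp_def by blast
    also have "\<dots> \<longleftrightarrow> (\<forall>u\<in>set ?L. \<forall>v\<in>set ?L.
        u < v \<longrightarrow> \<not> (snd v < y \<and> y \<le> snd u \<and> snd u \<le> H p))"
      using \<open>y \<le> H p\<close> by (intro ball_cong refl) (metis leD le_trans less_imp_le not_less)
    finally show ?thesis .
  qed
  have "set (zip (p # labs) (y # x)) = insert (p, y) (set ?L)" by simp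
  then have "(sorted_wrt (>) (zip (p # labs) (y # x)) \<and>
      (\<forall>(p, y)\<in>set (zip (p # labs) (y # x)). y \<le> H p) \<and>
      pattern_free H (set (zip (p # labs) (y # x)))) \<longleftrightarrow>
      y \<le> H p \<and> (\<forall>e\<in>set ?L. e < (p, y)) \<and> rest \<and>
      (\<forall>u\<in>set ?L. \<forall>v\<in>set ?L. u < v \<longrightarrow> \<not> (snd v < y \<and> y \<le> snd u \<and> snd u \<le> H p))"
    using pattern_free_insert[of "set ?L" "(p, y)" H] unfolding rest_def by auto
  then show ?case unfolding good using above fits by blast
qed

lemma card_fst_count: "distinct L \<Longrightarrow> card {y. (p, y) \<in> set L} = count_list (map fst L) p"
proof (induction L)
  case (Cons e L)
  have "{y. (p, y) \<in> set (e # L)} = (if fst e = p then insert (snd e) {y. (p, y) \<in> set L}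
      else {y. (p, y) \<in> set L})" by (cases e) auto
  moreover have "finite {y. (p, y) \<in> set L}"
    by (rule finite_subset[of _ "snd ` set L"]) force+
  ultimately show ?case using Cons by (cases e) auto
qed simp

lemma card_snd_count:
  assumes "distinct L"
  shows "card {p. (p, y) \<in> set L} = count_list (map snd L) y"
proof -
  have "{p. (p, y) \<in> set L} = {p. (y, p) \<in> set (map prod.swap L)}" by force
  moreover have "distinct (map prod.swap L)" using assms by (simp add: distinct_map swap_inj_on)
  ultimately show ?thesis using card_fst_count[of "map prod.swap L" y] by (simp add: comp_def)
qed

lemma sorted_wrt_greater_distinct:
  fixes L :: "'a::order list"
  shows "sorted_wrt (>) L \<Longrightarrow> distinct L"
  by (induction L) auto

lemma sorted_desc_unique:
  fixes xs ys :: "'a::linorder list"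
  assumes "sorted_wrt (\<ge>) xs" "sorted_wrt (\<ge>) ys" "\<And>z. count_list xs z = count_list ys z"
  shows "xs = ys"
proof -
  have "mset xs = mset ys" using assms(3) by (intro multiset_eqI) (simp add: count_mset)
  moreover have "sorted (rev xs)" "sorted (rev ys)" using assms by (auto simp: sorted_wrt_rev)
  ultimately have "rev xs = rev ys" by (metis mset_rev properties_for_sort)
  then show ?thesis by simp
qed

text \<open>List a placement in decreasing lexicographic order: the prescribed counts force the
  first components to be \<open>labs\<close>, so the second components carry all the
  information.\<close>

lemma bij_placements:
  assumes labs: "sorted_wrt (\<ge>) labs"
  shows "bij_betw (\<lambda>x. set (zip labs x))
    {x. good x (marks H labs) \<and> 0 \<notin> set x \<and> (\<forall>y>0. count_list x y = c y)} (placements H labs c)"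
    (is "bij_betw ?f ?X _")
  unfolding bij_betw_def
proof
  have len: "length labs = length x" if "x \<in> ?X" for x
  proof -
    have "length (marks H labs) = length labs" by (induction labs) (auto simp: marks_Cons)
    with that good_length show ?thesis by fastforce
  qed
  note good = good_marks[OF len labs]
  show "inj_on ?f ?X"
  proof
    fix x x' assume xx: "x \<in> ?X" "x' \<in> ?X" "?f x = ?f x'"
    have "sorted_wrt (<) (rev (zip labs x))" "sorted_wrt (<) (rev (zip labs x'))"
      using good[OF xx(1)] good[OF xx(2)] xx(1,2) by (auto simp: sorted_wrt_rev)
    with xx(3) have "rev (zip labs x) = rev (zip labs x')"
      by (intro strict_sorted_equal) auto
    then show "x = x'" using len[OF xx(1)] len[OF xx(2)] by (metis map_snd_zip rev_swap rev_rev_ident)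
  qed
  show "?f ` ?X = placements H labs c"
  proof (intro equalityI subsetI)
    fix G assume "G \<in> ?f ` ?X"
    then obtain x where x: "x \<in> ?X" "G = ?f x" by blast
    have s: "sorted_wrt (>) (zip labs x)" and r: "\<forall>(p, y)\<in>set (zip labs x). y \<le> H p"
      "pattern_free H (set (zip labs x))"
      using good[OF x(1)] x(1) by auto
    have d: "distinct (zip labs x)"
      using s by (rule sorted_wrt_greater_distinct)
    have "count_list x y = (if y = 0 then 0 else c y)" for y
      using x(1) by (auto simp: count_list_0_iff)
    then show "G \<in> placements H labs c"
      using r x(2) card_fst_count[OF d] card_snd_count[OF d] len[OF x(1)]
      by (simp add: placements_def)
  next
    fix G assume G: "G \<in> placements H labs c"
    then have fin: "finite G" by (simp add: placements_def)
    define L where "L = rev (sorted_list_of_set G)"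
    have L: "set L = G" "sorted_wrt (>) L" "distinct L"
      using fin by (auto simp: L_def sorted_wrt_rev strict_sorted_list_of_set)
    have "sorted_wrt (\<ge>) (map fst L)"
      unfolding sorted_wrt_map using L(2) by (rule sorted_wrt_mono_rel[rotated]) (auto simp: less_prod_def)
    moreover have "count_list (map fst L) p = count_list labs p" for p
      using card_fst_count[OF L(3), of p] G L(1) by (simp add: placements_def)
    ultimately have labsL: "map fst L = labs" using labs by (intro sorted_desc_unique)
    define x where "x = map snd L"
    have z: "zip labs x = L" "length labs = length x" unfolding x_def labsL[symmetric]
      by (simp_all add: zip_map_fst_snd)
    have c: "count_list x y = (if y = 0 then 0 else c y)" for y
      using card_snd_count[OF L(3), of y] G L(1) by (simp add: placements_def x_def)
    have "good x (marks H labs)"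
      using good_marks[OF z(2) labs, of H] G L unfolding z by (simp add: placements_def)
    moreover have "0 \<notin> set x" using c[of 0] by (simp add: count_list_0_iff)
    ultimately have "x \<in> ?X" using c by simp
    then show "G \<in> ?f ` ?X" using z L(1) by blast
  qed
qed

lemma card_placements:
  assumes "sorted_wrt (\<ge>) labs" "heights 0 E = marks H labs" "\<And>y. y > 0 \<Longrightarrow> content 0 E y = c y"
  shows "card (placements H labs c) = walk E []"
proof -
  \<comment> \<open>Starting from the empty word with m = 0 amounts to excluding the letter
    0.\<close>
  have "filter (\<lambda>z. z \<le> 0) x = [] \<longleftrightarrow> 0 \<notin> set x" for x :: "nat list"
    by (induction x) auto
  then have "words E 0 [] = {x. good x (marks H labs) \<and> 0 \<notin> set x \<and> (\<forall>y>0. count_list x y = c y)}"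
    using assms(3) by (simp add: words_def assms(2))
  then show ?thesis
    using bij_betw_same_card[OF bij_placements[OF assms(1), of H c]] card_words[of "[]" 0 E]
    by simp
qed

section \<open>Reading the border in both directions\<close>

text \<open>Applied to the rows above a given row; the default 0 lets the top row contribute a left
  step for each of its cells.\<close>

definition first_length :: "(nat \<times> nat) list \<Rightarrow> nat" where
  "first_length ps = (case ps of [] \<Rightarrow> 0 | p # _ \<Rightarrow> fst p)"

definition row_steps :: "nat \<Rightarrow> step list" where
  "row_steps a = (if a = 0 then [] else Row False # replicate (a - 1) (Row True))"

text \<open>The list consists of the pairs (length, multiplicity) of the rows, bottom row first.\<close>

fun border :: "(nat \<times> nat) list \<Rightarrow> step list" where
  "border [] = []"
| "border ((l, a) # ps) = row_steps a @ replicate (l - first_length ps) Col @ border ps"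

fun row_events :: "(nat \<times> nat) list \<Rightarrow> event list" where
  "row_events [] = []"
| "row_events ((l, a) # ps) = Ins a # replicate (l - first_length ps) (Rem False) @ row_events ps"

text \<open>From the upper left, a left step opens a new column, which holds exactly one 1, and a
  row step removes one 1 of the row.\<close>

fun col_event :: "step \<Rightarrow> event" where
  "col_event (Row b) = Rem b"
| "col_event Col = Ins 1"

definition col_events :: "(nat \<times> nat) list \<Rightarrow> event list" where
  "col_events ps = map col_event (rev (border ps))"

text \<open>The top row comes first, as in \<open>col_events\<close>, which makes the labels weakly
  decreasing.\<close>

fun row_labels :: "nat \<Rightarrow> (nat \<times> nat) list \<Rightarrow> nat list" where
  "row_labels k [] = []"
| "row_labels k ((l, a) # ps) = row_labels (Suc k) ps @ replicate a k"

lemma walk_rem: "walk (replicate k (Rem False) @ E) = (rem_op ^^ k) (walk E)"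
  by (induction k) auto

lemma foldr_replicate: "foldr f (replicate k x) = f x ^^ k"
  by (induction k) auto

lemma walk_row_events: "walk (row_events ps) = foldr up_op (border ps) empty_state"
  by (induction ps rule: border.induct) (auto simp: row_steps_def walk_rem foldr_replicate)

lemma walk_col_events: "walk (col_events ps) = fold down_op (border ps) empty_state"
proof -
  have "walk (map col_event Q) = foldr down_op Q empty_state" for Q
  proof (induction Q)
    case (Cons t Q)
    then show ?case by (cases t) auto
  qed simp
  then show ?thesis by (simp add: col_events_def foldr_conv_fold)
qed

lemma walk_events: "walk (row_events ps) [] = walk (col_events ps) []"
  by (simp add: walk_row_events walk_col_events up_down_walks)

lemma content_rem: "content m (replicate k (Rem b) @ E) = content m E"
  by (induction k) auto

lemma content_row_events:
  "r > m \<Longrightarrow> content m (row_events ps) r = (if r \<le> m + length ps then snd (ps ! (r - m - 1)) else 0)"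
proof (induction ps arbitrary: m rule: row_events.induct)
  case (2 l a ps)
  show ?case
  proof (cases "r = Suc m")
    case False
    with 2 have "Suc m < r" by simp
    moreover from this have "r - Suc 0 - m = Suc (r - Suc (Suc m))" by simp
    ultimately show ?thesis using "2.IH"[of "Suc m"] by (simp add: content_rem)
  qed simp
qed simp

lemma heights_rem: "heights m (replicate k (Rem b) @ E) = replicate k (m, b) @ heights m E"
  by (induction k) auto

lemma marks_strict: "sorted_wrt (>) ps \<Longrightarrow> marks H ps = map (\<lambda>p. (H p, False)) ps"
  by (induction ps) (auto simp: marks_Cons)

lemma first_length_le:
  "sorted_wrt (\<ge>) (map fst (p # ps)) \<Longrightarrow> first_length ps \<le> fst p"
  by (auto simp: first_length_def split: list.split)

text \<open>Columns are removed from right to left, column p as soon as all rows of length at least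
  p have been inserted.\<close>

lemma heights_row_events:
  "sorted_wrt (\<ge>) (map fst ps) \<Longrightarrow> heights m (row_events ps) =
    map (\<lambda>p. (m + length (filter (\<lambda>l. p \<le> l) (map fst ps)), False)) (rev [1..<Suc (first_length ps)])"
proof (induction ps arbitrary: m rule: row_events.induct)
  case (2 l a ps)
  let ?n = "first_length ps"
  have le: "?n \<le> l" using first_length_le[OF 2(2)] by simp
  then have "[1..<Suc l] = [1..<Suc ?n] @ [Suc ?n..<Suc l]"
    using upt_add_eq_append[of 1 "Suc ?n" "l - ?n"] by simp
  moreover have "map (\<lambda>p. (m + length (filter (\<lambda>l. p \<le> l) (map fst ((l, a) # ps))), False)) (rev [Suc ?n..<Suc l])
      = replicate (l - ?n) (Suc m, False)"
  proof -
    \<comment> \<open>Columns beyond the end of the next row meet only the current row.\<close>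
    have "filter (\<lambda>l. p \<le> l) (map fst ((l, a) # ps)) = [l]" if "p \<in> {Suc ?n..<Suc l}" for p
    proof -
      have "\<forall>k\<in>set (map fst ps). k \<le> ?n"
        using 2(2) by (cases ps) (auto simp: first_length_def)
      then have "filter (\<lambda>l. p \<le> l) (map fst ps) = []"
        using that by (auto simp: filter_empty_conv)
      then show ?thesis using that by simp
    qed
    then have "map (\<lambda>p. (m + length (filter (\<lambda>l. p \<le> l) (map fst ((l, a) # ps))), False)) (rev [Suc ?n..<Suc l])
      = map (\<lambda>p. (Suc m, False)) (rev [Suc ?n..<Suc l])"
      by (intro map_cong refl) (simp only: set_rev set_upt, simp)
    then show ?thesis by (simp add: map_replicate_const del: upt_Suc)
  qed
  moreover have "heights (Suc m) (row_events ps) =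
      map (\<lambda>p. (m + length (filter (\<lambda>l. p \<le> l) (map fst ((l, a) # ps))), False)) (rev [1..<Suc ?n])"
    using 2 le by (simp del: upt_Suc)
  ultimately show ?case
    by (simp add: heights_rem first_length_def[of "(l, a) # ps"] del: upt_Suc list.map filter.simps)
qed (simp add: first_length_def)

lemma heights_append_map:
  "heights m (map col_event (P @ Q)) =
    heights m (map col_event P) @ heights (m + count_list P Col) (map col_event Q)"
proof (induction P arbitrary: m)
  case (Cons t P)
  then show ?case by (cases t) auto
qed simp

lemma content_map_col:
  "r > m \<Longrightarrow> content m (map col_event Q) r = (if r \<le> m + count_list Q Col then 1 else 0)"
proof (induction Q arbitrary: m)
  case (Cons t Q)
  then show ?case by (cases t) auto
qed simp

lemma count_replicate: "count_list (replicate k x) y = (if x = y then k else 0)"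
  by (induction k) auto

text \<open>The differences of consecutive row lengths telescope.\<close>

lemma count_border: "sorted_wrt (\<ge>) (map fst ps) \<Longrightarrow> count_list (border ps) Col = first_length ps"
proof (induction ps rule: border.induct)
  case (2 l a ps)
  then show ?case using first_length_le[OF 2(2)]
    by (simp add: row_steps_def count_replicate first_length_def[of "(l, a) # ps"])
qed (simp add: first_length_def)

lemma marks_append:
  assumes "k \<notin> set xs"
  shows "marks H (xs @ replicate a k) = marks H xs @ marks H (replicate a k)"
  using assms
proof (induction xs)
  case (Cons x xs)
  moreover have "a > 0 \<Longrightarrow> hd (replicate a k) = k" by (cases a) auto
  ultimately show ?case by (cases "xs = []"; cases "a = 0") (auto simp: marks_Cons)
qed simp

lemma marks_replicate: "marks H (replicate (Suc a) k) = replicate a (H k, True) @ [(H k, False)]"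
  by (induction a) (auto simp: marks_Cons)

lemma row_labels_ge: "p \<in> set (row_labels k ps) \<Longrightarrow> k \<le> p"
  by (induction k ps rule: row_labels.induct) (auto simp: Suc_le_eq intro: less_imp_le)

lemma sorted_row_labels: "sorted_wrt (\<ge>) (row_labels k ps)"
proof (induction k ps rule: row_labels.induct)
  case (2 k l a ps)
  have "sorted_wrt (\<ge>) (replicate a k)" by (induction a) auto
  with 2 show ?case by (auto simp: sorted_wrt_append dest: row_labels_ge)
qed simp

lemma count_row_labels:
  "count_list (row_labels k ps) p = (if k \<le> p \<and> p < k + length ps then snd (ps ! (p - k)) else 0)"
proof (induction k ps rule: row_labels.induct)
  case (2 k l a ps)
  then show ?case by (auto simp: count_replicate nth_Cons split: nat.split)
    (metis Suc_diff_le Suc_leI diff_Suc_Suc le_neq_implies_less nat.inject)+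
qed simp

text \<open>When a row is reached from above, one column has been inserted for each of its cells, so
  the recorded height is the length of the row.\<close>

lemma heights_col_events:
  assumes "sorted_wrt (\<ge>) (map fst ps)" "\<And>i. i < length ps \<Longrightarrow> H (k + i) = fst (ps ! i)"
  shows "heights 0 (col_events ps) = marks H (row_labels k ps)"
  using assms
proof (induction k ps rule: row_labels.induct)
  case (2 k l a ps)
  have le: "first_length ps \<le> l" using first_length_le[OF 2(2)] by simp
  have H: "H k = l" using 2(3)[of 0] by simp
  have IH: "heights 0 (col_events ps) = marks H (row_labels (Suc k) ps)"
    using 2(2) 2(3)[of "Suc _"] by (intro 2) auto
  have cols: "heights n (map col_event (replicate i Col)) = []" for n i
    by (induction i arbitrary: n) auto
  have rows: "heights l (map col_event (rev (row_steps a))) = marks H (replicate a k)"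
  proof (cases a)
    case (Suc b)
    have "heights l (replicate i (Rem True) @ [Rem False]) = replicate i (l, True) @ [(l, False)]" for i
      by (induction i) auto
    with Suc show ?thesis using H marks_replicate[of H b k] by (simp add: row_steps_def)
  qed (simp add: row_steps_def)
  have "heights 0 (col_events ((l, a) # ps)) = heights 0 (col_events ps)
      @ heights l (map col_event (rev (row_steps a)))"
    using le 2(2) unfolding col_events_def
    by (simp add: heights_append_map count_border count_replicate cols del: map_append map_replicate)
  moreover have "k \<notin> set (row_labels (Suc k) ps)" using row_labels_ge by force
  ultimately show ?case using IH rows by (simp add: marks_append)
qed (simp add: col_events_def)

section \<open>Fillings as placements\<close>

lemma length_filter_ge:
  fixes lam :: "nat list"
  shows "sorted_wrt (\<ge>) lam \<Longrightarrow> i < length (filter (\<lambda>l. j \<le> l) lam) \<longleftrightarrow> i < length lam \<and> j \<le> lam ! i"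
proof (induction lam arbitrary: i)
  case (Cons l lam)
  have "\<forall>k\<in>set lam. k \<le> l" using Cons.prems by simp
  then have "filter (\<lambda>l. j \<le> l) lam = []" if "\<not> j \<le> l"
    using that by (intro filter_False) auto
  with Cons show ?case by (cases i) (auto dest: nth_mem)
qed simp

lemma cells_col_height:
  assumes "ferrers lam"
  shows "(i, j) \<in> cells lam \<longleftrightarrow> 1 \<le> i \<and> 1 \<le> j \<and> i \<le> length (filter (\<lambda>l. j \<le> l) lam)"
  using length_filter_ge[of lam "i - 1" j] assms by (auto simp: cells_def ferrers_def)

lemma cells_down:
  assumes "ferrers lam" "(i, j) \<in> cells lam" "1 \<le> i'" "i' \<le> i" "1 \<le> j'" "j' \<le> j"
  shows "(i', j') \<in> cells lam"
proof -
  have "lam ! (i - 1) \<le> lam ! (i' - 1)"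
    using assms by (cases "i' = i") (auto simp: ferrers_def cells_def sorted_wrt_iff_nth_less)
  with assms show ?thesis by (auto simp: cells_def)
qed

lemma cells_column_iff:
  assumes "ferrers lam"
  shows "(\<exists>i. (i, j) \<in> cells lam) \<longleftrightarrow> 1 \<le> j \<and> lam \<noteq> [] \<and> j \<le> hd lam"
proof
  assume "\<exists>i. (i, j) \<in> cells lam"
  then have "(1, j) \<in> cells lam" using cells_down[OF assms, of _ j 1 j] by (auto simp: cells_def)
  then show "1 \<le> j \<and> lam \<noteq> [] \<and> j \<le> hd lam" by (cases lam) (auto simp: cells_def)
next
  assume "1 \<le> j \<and> lam \<noteq> [] \<and> j \<le> hd lam"
  then have "(1, j) \<in> cells lam" by (auto simp: cells_def hd_conv_nth Suc_le_eq)
  then show "\<exists>i. (i, j) \<in> cells lam" ..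
qed

lemma finite_cells: "finite (cells lam)"
proof (rule finite_subset)
  show "cells lam \<subseteq> {..length lam} \<times> {..Max (set lam)}"
    by (auto simp: cells_def intro!: le_trans[OF _ Max_ge] nth_mem)
qed simp

lemma finite_sections: "finite F \<Longrightarrow> finite {j. (i, j) \<in> F}" "finite F \<Longrightarrow> finite {i. (i, j) \<in> F}"
  by (rule finite_subset[of _ "snd ` F"] finite_subset[of _ "fst ` F"]; force)+

text \<open>As a column of F has at most one 1, the ones of an occurrence force its zeros; as the
  shape is closed downwards and to the left, the upper right corner brings in all other
  cells.\<close>

lemma contains_word_iff:
  assumes lam: "ferrers lam" and F: "F \<subseteq> cells lam"
    and col: "\<And>i i' j. (i, j) \<in> F \<Longrightarrow> (i', j) \<in> F \<Longrightarrow> i = i'"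
    and x: "x \<noteq> []" "set x = {1..M}"
  shows "contains_word lam F x \<longleftrightarrow> (\<exists>\<rho> c. strict_mono_on {1..M} \<rho> \<and> strict_mono_on {1..length x} c \<and>
    (\<forall>j\<in>{1..length x}. (\<rho> (x ! (j - 1)), c j) \<in> F) \<and> (\<rho> M, c (length x)) \<in> cells lam)"
proof -
  have "{1..M} \<noteq> {}" using x by (metis set_empty)
  then have M: "1 \<le> M" "Max (set x) = M" unfolding x(2) by (auto intro!: Max_eqI)
  have mem: "x ! (j - 1) \<in> {1..M}" if "j \<in> {1..length x}" for j
    using that x(2) nth_mem[of "j - 1" x] by auto
  have "(\<forall>l\<in>{1..M}. \<forall>j\<in>{1..length x}. (\<rho> l, c j) \<in> cells lam \<and> ((\<rho> l, c j) \<in> F \<longleftrightarrow> x ! (j - 1) = l)) \<longleftrightarrow>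
     (\<forall>j\<in>{1..length x}. (\<rho> (x ! (j - 1)), c j) \<in> F) \<and> (\<rho> M, c (length x)) \<in> cells lam"
    (is "?A \<longleftrightarrow> ?B") if mono: "strict_mono_on {1..M} \<rho>" "strict_mono_on {1..length x} c" for \<rho> c
  proof
    assume ?A
    moreover have "M \<in> {1..M}" "length x \<in> {1..length x}" using M x by (auto simp: Suc_le_eq)
    ultimately show ?B using mem by blast
  next
    assume B: ?B
    show ?A
    proof (intro ballI conjI)
      fix l j assume l: "l \<in> {1..M}" and j: "j \<in> {1..length x}"
      \<comment> \<open>Every letter l occurs in x, so the chosen row \<rho> l holds a 1 and is a
        genuine row of the shape.\<close>
      obtain t where t: "t \<in> {1..length x}" "x ! (t - 1) = l"
      proof -
        have "l \<in> set x" using l x by simp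
        then obtain i where "i < length x" "x ! i = l" by (auto simp: in_set_conv_nth)
        then show ?thesis by (intro that[of "Suc i"]) auto
      qed
      have "(\<rho> l, c t) \<in> cells lam" "(\<rho> (x ! (j - 1)), c j) \<in> cells lam"
        using B t j F by auto
      then have "1 \<le> \<rho> l" "1 \<le> c j" by (auto simp: cells_def)
      moreover have "\<rho> l \<le> \<rho> M" "c j \<le> c (length x)"
        using l j strict_mono_on_leD[OF mono(1), of l M]
          strict_mono_on_leD[OF mono(2), of j "length x"] by simp_all
      ultimately show "(\<rho> l, c j) \<in> cells lam" using cells_down[OF lam] B by blast
      have "(\<rho> (x ! (j - 1)), c j) \<in> F" using B j by blast
      moreover have "\<rho> (x ! (j - 1)) = \<rho> l \<longleftrightarrow> x ! (j - 1) = l"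
        using mem[OF j] l mono(1) strict_mono_on_eqD by metis
      ultimately show "(\<rho> l, c j) \<in> F \<longleftrightarrow> x ! (j - 1) = l" using col by metis
    qed
  qed
  then show ?thesis unfolding contains_word_def M(2) Let_def by blast
qed

lemma atLeastAtMost_upto_3: "{1..3} = {1, 2, 3 :: nat}" "{1..2} = {1, 2 :: nat}"
  by auto

lemma ex_strict_mono_3:
  "(\<exists>c :: nat \<Rightarrow> nat. strict_mono_on {1..3} c \<and> P (c 1) (c 2) (c 3)) \<longleftrightarrow> (\<exists>c1 c2 c3. c1 < c2 \<and> c2 < c3 \<and> P c1 c2 c3)"
proof
  assume "\<exists>c1 c2 c3. c1 < c2 \<and> c2 < c3 \<and> P c1 c2 c3"
  then obtain c1 c2 c3 where c: "c1 < c2" "c2 < c3" "P c1 c2 c3" by blast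
  let ?c = "\<lambda>i :: nat. if i = 1 then c1 else if i = 2 then c2 else c3"
  have "strict_mono_on {1..3} ?c"
    using c unfolding atLeastAtMost_upto_3 by (auto simp: strict_mono_on_def)
  moreover have "P (?c 1) (?c 2) (?c 3)" using c by simp
  ultimately show "\<exists>c :: nat \<Rightarrow> nat. strict_mono_on {1..3} c \<and> P (c 1) (c 2) (c 3)" by blast
next
  assume "\<exists>c :: nat \<Rightarrow> nat. strict_mono_on {1..3} c \<and> P (c 1) (c 2) (c 3)"
  then obtain c :: "nat \<Rightarrow> nat" where "strict_mono_on {1..3} c" "P (c 1) (c 2) (c 3)" by blast
  moreover from this have "c 1 < c 2" "c 2 < c 3" by (auto elim!: strict_mono_onD)
  ultimately show "\<exists>c1 c2 c3. c1 < c2 \<and> c2 < c3 \<and> P c1 c2 c3" by blast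
qed

lemma ex_strict_mono_2:
  "(\<exists>c :: nat \<Rightarrow> nat. strict_mono_on {1..2} c \<and> P (c 1) (c 2)) \<longleftrightarrow> (\<exists>c1 c2. c1 < c2 \<and> P c1 c2)"
proof
  assume "\<exists>c1 c2. c1 < c2 \<and> P c1 c2"
  then obtain c1 c2 where c: "c1 < c2" "P c1 c2" by blast
  let ?c = "\<lambda>i :: nat. if i = 1 then c1 else c2"
  have "strict_mono_on {1..2} ?c"
    using c unfolding atLeastAtMost_upto_3 by (auto simp: strict_mono_on_def)
  moreover have "P (?c 1) (?c 2)" using c by simp
  ultimately show "\<exists>c :: nat \<Rightarrow> nat. strict_mono_on {1..2} c \<and> P (c 1) (c 2)" by blast
next
  assume "\<exists>c :: nat \<Rightarrow> nat. strict_mono_on {1..2} c \<and> P (c 1) (c 2)"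
  then obtain c :: "nat \<Rightarrow> nat" where "strict_mono_on {1..2} c" "P (c 1) (c 2)" by blast
  moreover from this have "c 1 < c 2" by (auto elim!: strict_mono_onD)
  ultimately show "\<exists>c1 c2. c1 < c2 \<and> P c1 c2" by blast
qed

context
  fixes lam :: "nat list" and F :: "(nat \<times> nat) set"
  assumes lam: "ferrers lam" and F: "F \<subseteq> cells lam"
    and col: "\<And>i i' j. (i, j) \<in> F \<Longrightarrow> (i', j) \<in> F \<Longrightarrow> i = i'"
begin

lemma contains_word_3:
  assumes "set [u, v, w] = {1..3}"
  shows "contains_word lam F [u, v, w] \<longleftrightarrow> (\<exists>r1 r2 r3 c1 c2 c3. r1 < r2 \<and> r2 < r3 \<and> c1 < c2 \<and> c2 < c3 \<and>
    ([r1, r2, r3] ! (u - 1), c1) \<in> F \<and> ([r1, r2, r3] ! (v - 1), c2) \<in> F \<and>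
    ([r1, r2, r3] ! (w - 1), c3) \<in> F \<and> (r3, c3) \<in> cells lam)"
proof -
  have *: "\<rho> i = [\<rho> 1, \<rho> 2, \<rho> 3] ! (i - 1)" if "i \<in> set [u, v, w]" for \<rho> :: "nat \<Rightarrow> nat" and i
    using that unfolding assms atLeastAtMost_upto_3 by auto
  let ?P = "\<lambda>r1 r2 r3 c1 c2 c3. ([r1, r2, r3] ! (u - 1), c1) \<in> F \<and> ([r1, r2, r3] ! (v - 1), c2) \<in> F \<and>
    ([r1, r2, r3] ! (w - 1), c3) \<in> F \<and> (r3, c3) \<in> cells lam"
  have "contains_word lam F [u, v, w] \<longleftrightarrow> (\<exists>\<rho> (c :: nat \<Rightarrow> nat). strict_mono_on {1..3} \<rho> \<and> strict_mono_on {1..3} c \<and>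
     (\<rho> u, c 1) \<in> F \<and> (\<rho> v, c 2) \<in> F \<and> (\<rho> w, c 3) \<in> F \<and> (\<rho> 3, c 3) \<in> cells lam)"
    by (subst contains_word_iff[OF lam F col _ assms])
       (simp_all add: numeral_3_eq_3 numeral_2_eq_2 atLeastAtMostSuc_conv conj_ac)
  also have "\<dots> \<longleftrightarrow> (\<exists>\<rho> :: nat \<Rightarrow> nat. strict_mono_on {1..3} \<rho> \<and> (\<exists>c :: nat \<Rightarrow> nat. strict_mono_on {1..3} c \<and>
     ?P (\<rho> 1) (\<rho> 2) (\<rho> 3) (c 1) (c 2) (c 3)))"
    using *[of u] *[of v] *[of w] by simp
  also have "\<dots> \<longleftrightarrow> (\<exists>r1 r2 r3. r1 < r2 \<and> r2 < r3 \<and> (\<exists>c1 c2 c3. c1 < c2 \<and> c2 < c3 \<and> ?P r1 r2 r3 c1 c2 c3))"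
    unfolding ex_strict_mono_3[where P = "?P r1 r2 r3" for r1 r2 r3]
    by (rule ex_strict_mono_3[where P = "\<lambda>r1 r2 r3. \<exists>c1 c2 c3. c1 < c2 \<and> c2 < c3 \<and> ?P r1 r2 r3 c1 c2 c3"])
  finally show ?thesis by blast
qed

lemma contains_word_2:
  assumes "set [u, v, w] = {1..2}"
  shows "contains_word lam F [u, v, w] \<longleftrightarrow> (\<exists>r1 r2 c1 c2 c3. r1 < r2 \<and> c1 < c2 \<and> c2 < c3 \<and>
    ([r1, r2] ! (u - 1), c1) \<in> F \<and> ([r1, r2] ! (v - 1), c2) \<in> F \<and>
    ([r1, r2] ! (w - 1), c3) \<in> F \<and> (r2, c3) \<in> cells lam)"
proof -
  have *: "\<rho> i = [\<rho> 1, \<rho> 2] ! (i - 1)" if "i \<in> set [u, v, w]" for \<rho> :: "nat \<Rightarrow> nat" and i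
    using that unfolding assms atLeastAtMost_upto_3 by auto
  let ?P = "\<lambda>r1 r2 c1 c2 c3. ([r1, r2] ! (u - 1), c1) \<in> F \<and> ([r1, r2] ! (v - 1), c2) \<in> F \<and>
    ([r1, r2] ! (w - 1), c3) \<in> F \<and> (r2, c3) \<in> cells lam"
  have "contains_word lam F [u, v, w] \<longleftrightarrow> (\<exists>\<rho> (c :: nat \<Rightarrow> nat). strict_mono_on {1..2} \<rho> \<and> strict_mono_on {1..3} c \<and>
     (\<rho> u, c 1) \<in> F \<and> (\<rho> v, c 2) \<in> F \<and> (\<rho> w, c 3) \<in> F \<and> (\<rho> 2, c 3) \<in> cells lam)"
    by (subst contains_word_iff[OF lam F col _ assms])
       (simp_all add: numeral_3_eq_3 numeral_2_eq_2 atLeastAtMostSuc_conv conj_ac)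
  also have "\<dots> \<longleftrightarrow> (\<exists>\<rho> :: nat \<Rightarrow> nat. strict_mono_on {1..2} \<rho> \<and> (\<exists>c :: nat \<Rightarrow> nat. strict_mono_on {1..3} c \<and>
     ?P (\<rho> 1) (\<rho> 2) (c 1) (c 2) (c 3)))"
    using *[of u] *[of v] *[of w] by simp
  also have "\<dots> \<longleftrightarrow> (\<exists>r1 r2. r1 < r2 \<and> (\<exists>c1 c2 c3. c1 < c2 \<and> c2 < c3 \<and> ?P r1 r2 c1 c2 c3))"
    unfolding ex_strict_mono_3[where P = "?P r1 r2" for r1 r2]
    by (rule ex_strict_mono_2[where P = "\<lambda>r1 r2. \<exists>c1 c2 c3. c1 < c2 \<and> c2 < c3 \<and> ?P r1 r2 c1 c2 c3"])
  finally show ?thesis by blast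
qed

lemma cells_F: "(i, j) \<in> F \<Longrightarrow> 1 \<le> i \<and> i \<le> length lam \<and> 1 \<le> j"
  using F by (auto simp: cells_def)

lemma avoids_231_221:
  "(\<forall>x\<in>{[2, 3, 1], [2, 2, 1]}. \<not> contains_word lam F x) \<longleftrightarrow> pattern_free (\<lambda>r. lam ! (r - 1)) F"
proof -
  have set: "set [2, 3, 1 :: nat] = {1..3}" "set [2, 2, 1 :: nat] = {1..2}" by auto
  have "contains_word lam F [2, 3, 1] \<or> contains_word lam F [2, 2, 1] \<longleftrightarrow>
    (\<exists>r1 r2 r3 c1 c2 c3. r1 < r2 \<and> r2 \<le> r3 \<and> c1 < c2 \<and> c2 < c3 \<and>
      (r2, c1) \<in> F \<and> (r3, c2) \<in> F \<and> (r1, c3) \<in> F \<and> (r3, c3) \<in> cells lam)"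
    unfolding contains_word_3[OF set(1)] contains_word_2[OF set(2)] le_less
    by (simp add: numeral_2_eq_2) blast
  also have "\<dots> \<longleftrightarrow> (\<exists>u\<in>F. \<exists>v\<in>F. \<exists>w\<in>F. u < v \<and> v < w \<and>
      snd v < snd w \<and> snd w \<le> snd u \<and> snd u \<le> lam ! (fst w - 1))" (is "?A \<longleftrightarrow> ?B")
  proof
    assume ?A
    then obtain r1 r2 r3 c1 c2 c3 where *: "r1 < r2" "r2 \<le> r3" "c1 < c2" "c2 < c3"
      "(r2, c1) \<in> F" "(r3, c2) \<in> F" "(r1, c3) \<in> F" "(r3, c3) \<in> cells lam" by blast
    \<comment> \<open>Sorted by rows, the ones lie in columns c3, c1, c2; if r2 = r3, the order c1 <
      c2 still puts the pairs in lexicographic order.\<close>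
    then show ?B
      by (intro bexI[of _ "(r1, c3)"] bexI[of _ "(r2, c1)"] bexI[of _ "(r3, c2)"]) (auto simp: cells_def)
  next
    assume ?B
    then obtain p1 y1 p2 y2 p3 y3 where *: "(p1, y1) \<in> F" "(p2, y2) \<in> F" "(p3, y3) \<in> F"
      "(p1, y1) < (p2, y2)" "(p2, y2) < (p3, y3)" "y2 < y3" "y3 \<le> y1" "y1 \<le> lam ! (p3 - 1)"
      by fastforce
    then have "p1 < p2" "p2 \<le> p3" by auto
    \<comment> \<open>Equality would put two ones, in the different rows p1 and p3, into one
      column.\<close>
    moreover have "y3 < y1" using * col[of p1 y1 p3] calculation by (cases "y3 = y1") auto
    moreover have "(p3, y1) \<in> cells lam" using * cells_F[of p3 y3] cells_F[of p1 y1] by (simp add: cells_def)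
    ultimately show ?A using * by blast
  qed
  finally show ?thesis unfolding pattern_free_def by blast
qed

lemma avoids_312_212:
  "(\<forall>x\<in>{[3, 1, 2], [2, 1, 2]}. \<not> contains_word lam F x) \<longleftrightarrow>
    pattern_free (\<lambda>j. length (filter (\<lambda>l. j \<le> l) lam)) (F\<inverse>)"
proof -
  have set: "set [3, 1, 2 :: nat] = {1..3}" "set [2, 1, 2 :: nat] = {1..2}" by auto
  have "contains_word lam F [3, 1, 2] \<or> contains_word lam F [2, 1, 2] \<longleftrightarrow>
    (\<exists>r1 r2 r3 c1 c2 c3. r1 < r2 \<and> r2 \<le> r3 \<and> c1 < c2 \<and> c2 < c3 \<and>
      (r3, c1) \<in> F \<and> (r1, c2) \<in> F \<and> (r2, c3) \<in> F \<and> (r3, c3) \<in> cells lam)"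
    unfolding contains_word_3[OF set(1)] contains_word_2[OF set(2)] le_less
    by (simp add: numeral_2_eq_2) blast
  also have "\<dots> \<longleftrightarrow> (\<exists>u\<in>F\<inverse>. \<exists>v\<in>F\<inverse>. \<exists>w\<in>F\<inverse>. u < v \<and> v < w \<and>
      snd v < snd w \<and> snd w \<le> snd u \<and> snd u \<le> length (filter (\<lambda>l. fst w \<le> l) lam))" (is "?A \<longleftrightarrow> ?B")
  proof
    assume ?A
    then obtain r1 r2 r3 c1 c2 c3 where *: "r1 < r2" "r2 \<le> r3" "c1 < c2" "c2 < c3"
      "(r3, c1) \<in> F" "(r1, c2) \<in> F" "(r2, c3) \<in> F" "(r3, c3) \<in> cells lam" by blast
    then show ?B
      by (intro bexI[of _ "(c1, r3)"] bexI[of _ "(c2, r1)"] bexI[of _ "(c3, r2)"])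
         (auto simp: cells_col_height[OF lam])
  next
    assume ?B
    then obtain p1 y1 p2 y2 p3 y3 where *: "(y1, p1) \<in> F" "(y2, p2) \<in> F" "(y3, p3) \<in> F"
      "(p1, y1) < (p2, y2)" "(p2, y2) < (p3, y3)" "y2 < y3" "y3 \<le> y1"
      "y1 \<le> length (filter (\<lambda>l. p3 \<le> l) lam)"
      by fastforce
    then have "p1 \<noteq> p2" "p2 \<noteq> p3" using col[of y1 p1 y2] col[of y2 p2 y3] by auto
    then have "p1 < p2" "p2 < p3" using * by auto
    moreover have "(y1, p3) \<in> cells lam"
      using * cells_F[of y3 p3] cells_F[of y1 p1] by (simp add: cells_col_height[OF lam])
    ultimately show ?A using * by blast
  qed
  finally show ?thesis unfolding pattern_free_def by blast
qed

end

section \<open>Counting the fillings of a fixed shape by walks\<close>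

context
  fixes lam a :: "nat list"
  assumes lam: "ferrers lam" and le: "length a \<le> length lam"
begin

text \<open>Pads \<open>a\<close> by zeros, so that every row of the shape has a
  multiplicity.\<close>

definition row_mult :: "nat \<Rightarrow> nat" where
  "row_mult i = (if 1 \<le> i \<and> i \<le> length a then a ! (i - 1) else 0)"

definition rows :: "(nat \<times> nat) list" where
  "rows = zip lam (map row_mult [1..<Suc (length lam)])"

lemma rows_simps:
  "map fst rows = lam" "length rows = length lam"
  "i < length lam \<Longrightarrow> fst (rows ! i) = lam ! i"
  "i < length lam \<Longrightarrow> snd (rows ! i) = row_mult (Suc i)"
  by (simp_all add: rows_def del: upt_Suc)

lemma sorted_rows: "sorted_wrt (\<ge>) (map fst rows)"
  using lam by (simp add: rows_simps ferrers_def)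

lemma first_length_rows: "first_length rows = (if lam = [] then 0 else hd lam)"
  using rows_simps(1,2) by (cases rows; cases lam) (auto simp: first_length_def)

definition columns :: "nat list" where
  "columns = rev [1..<Suc (first_length rows)]"

definition column_filled :: "nat \<Rightarrow> nat" where
  "column_filled j = (if j \<le> first_length rows then 1 else 0)"

lemma in_column_iff: "(\<exists>i. (i, j) \<in> cells lam) \<longleftrightarrow> 1 \<le> j \<and> j \<le> first_length rows"
  using cells_column_iff[OF lam, of j] by (auto simp: first_length_rows)

lemma count_columns: "count_list columns j = (if 1 \<le> j \<and> j \<le> first_length rows then 1 else 0)"
proof -
  have "count_list [1..<Suc n] j = (if 1 \<le> j \<and> j \<le> n then 1 else 0)" for n
    by (induction n) auto
  then show ?thesis by (simp add: columns_def del: upt_Suc)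
qed

lemma count_rows: "count_list (row_labels 1 rows) i = row_mult i"
  using le by (auto simp: count_row_labels rows_simps row_mult_def)

definition filling :: "(nat \<times> nat) set \<Rightarrow> bool" where
  "filling F \<longleftrightarrow> F \<subseteq> cells lam \<and> (\<forall>j. card {i. (i, j) \<in> F} = (if j = 0 then 0 else column_filled j)) \<and>
     (\<forall>i. card {j. (i, j) \<in> F} = row_mult i)"

lemma filling_column_unique:
  assumes "filling F" "(i, j) \<in> F" "(i', j) \<in> F"
  shows "i = i'"
proof -
  have "card {i. (i, j) \<in> F} \<le> 1" using assms(1) by (simp add: filling_def column_filled_def)
  moreover have "finite {i. (i, j) \<in> F}"
    using assms(1) finite_subset[OF _ finite_cells, of F lam] by (simp add: filling_def finite_sections)
  ultimately show ?thesis using assms(2,3) by (simp add: card_le_Suc0_iff_eq)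
qed

text \<open>Row 0 and the columns outside the shape contain no cells, so the counting conditions
  extend to all indices.\<close>

lemma W_eq: "W lam a \<Omega> = {F. filling F \<and> (\<forall>x\<in>\<Omega>. \<not> contains_word lam F x)}"
proof -
  have columns: "(\<forall>j. 1 \<le> j \<and> (\<exists>i. (i, j) \<in> cells lam) \<longrightarrow> card {i. (i, j) \<in> F} = 1) \<longleftrightarrow>
      (\<forall>j. card {i. (i, j) \<in> F} = (if j = 0 then 0 else column_filled j))" (is "?A \<longleftrightarrow> ?B")
    and rows: "(\<forall>i. 1 \<le> i \<longrightarrow> card {j. (i, j) \<in> F} = (if i \<le> length a then a ! (i - 1) else 0)) \<longleftrightarrow>
      (\<forall>i. card {j. (i, j) \<in> F} = row_mult i)" (is "?C \<longleftrightarrow> ?D")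
    if F: "F \<subseteq> cells lam" for F
  proof -
    have empty: "{i. (i, j) \<in> F} = {}" if "\<not> (\<exists>i. (i, j) \<in> cells lam)" for j
      using that F by auto
    show "?A \<longleftrightarrow> ?B"
    proof
      assume A: ?A
      show ?B
      proof
        fix j
        show "card {i. (i, j) \<in> F} = (if j = 0 then 0 else column_filled j)"
          using A empty[of j] unfolding in_column_iff column_filled_def
          by (cases "1 \<le> j \<and> j \<le> first_length rows") auto
      qed
    qed (auto simp: in_column_iff column_filled_def)
    have "{j. (0, j) \<in> F} = {}" using F by (auto simp: cells_def)
    then have "card {j. (i, j) \<in> F} = row_mult i" if "i = 0" for i
      using that by (simp add: row_mult_def)
    then show "?C \<longleftrightarrow> ?D" unfolding row_mult_def by (metis less_one not_le)
  qed
  show ?thesis unfolding W_def filling_def conj_assoc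
    by (intro Collect_cong conj_cong refl columns rows)
qed

lemma card_W_231_221: "card (W lam a {[2, 3, 1], [2, 2, 1]}) = walk (col_events rows) []"
proof -
  let ?H = "\<lambda>r. lam ! (r - 1)"
  have "F \<in> W lam a {[2, 3, 1], [2, 2, 1]} \<longleftrightarrow> F \<in> placements ?H (row_labels 1 rows) column_filled" for F
  proof -
    \<comment> \<open>A pair with an index out of range would lie in a row or column of prescribed
      count 0. Finiteness matters, since infinite sets also have cardinality 0.\<close>
    have cells: "F \<subseteq> cells lam \<longleftrightarrow> finite F \<and> (\<forall>(p, y)\<in>F. y \<le> ?H p)"
      if row: "\<forall>i. card {j. (i, j) \<in> F} = row_mult i"
        and col: "\<forall>j. card {i. (i, j) \<in> F} = (if j = 0 then 0 else column_filled j)"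
    proof
      assume "F \<subseteq> cells lam"
      then show "finite F \<and> (\<forall>(p, y)\<in>F. y \<le> ?H p)"
        using finite_subset[OF _ finite_cells] by (auto simp: cells_def)
    next
      assume F: "finite F \<and> (\<forall>(p, y)\<in>F. y \<le> ?H p)"
      show "F \<subseteq> cells lam"
      proof clarify
        fix p y assume py: "(p, y) \<in> F"
        have "finite {j. (p, j) \<in> F}" "finite {i. (i, y) \<in> F}"
          using F by (simp_all add: finite_sections)
        with py have "card {j. (p, j) \<in> F} \<noteq> 0" "card {i. (i, y) \<in> F} \<noteq> 0" by auto
        then have "row_mult p \<noteq> 0" "y \<noteq> 0" using row col by (metis, metis)
        then show "(p, y) \<in> cells lam"
          using F py le by (auto simp: cells_def row_mult_def split: if_splits)
      qed
    qed
    have pattern: "(\<forall>x\<in>{[2, 3, 1], [2, 2, 1]}. \<not> contains_word lam F x) \<longleftrightarrow> pattern_free ?H F"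
      if "filling F"
      by (rule avoids_231_221[OF lam _ filling_column_unique[OF that]])
         (use that in \<open>simp add: filling_def\<close>)
    \<comment> \<open>The two equivalences hold only under the counting conditions, so the conjuncts
      are exchanged conditionally.\<close>
    have combine: "(S \<and> C \<and> R) \<and> A \<longleftrightarrow> N \<and> R \<and> B \<and> C \<and> P"
      if "R \<Longrightarrow> C \<Longrightarrow> S = (N \<and> B)" "S \<and> C \<and> R \<Longrightarrow> A = P" for S C R A N B P
      using that by blast
    show ?thesis
      unfolding W_eq placements_def count_rows mem_Collect_eq filling_def
      by (rule combine[OF cells pattern[unfolded filling_def]])
  qed
  then have "W lam a {[2, 3, 1], [2, 2, 1]} = placements ?H (row_labels 1 rows) column_filled" by blast
  moreover have "content 0 (col_events rows) y = column_filled y" if "y > 0" for y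
    using that count_border[OF sorted_rows]
    by (simp add: col_events_def content_map_col column_filled_def)
  moreover have "heights 0 (col_events rows) = marks ?H (row_labels 1 rows)"
    by (rule heights_col_events[OF sorted_rows]) (simp add: rows_simps)
  ultimately show ?thesis
    using card_placements[OF sorted_row_labels, where c = column_filled] by simp
qed

text \<open>Columns are now the labels and rows the letters, so fillings are transposed; the labels
  are distinct and no removal is flagged.\<close>

lemma card_W_312_212: "card (W lam a {[3, 1, 2], [2, 1, 2]}) = walk (row_events rows) []"
proof -
  let ?H = "\<lambda>j. length (filter (\<lambda>l. j \<le> l) lam)"
  have W_iff: "F \<in> W lam a {[3, 1, 2], [2, 1, 2]} \<longleftrightarrow> F\<inverse> \<in> placements ?H columns row_mult" for F
  proof -
    have cells: "F \<subseteq> cells lam \<longleftrightarrow> finite F \<and> (\<forall>(p, y)\<in>F\<inverse>. y \<le> ?H p)"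
      if row: "\<forall>i. card {j. (i, j) \<in> F} = row_mult i"
        and col: "\<forall>j. card {i. (i, j) \<in> F} = (if j = 0 then 0 else column_filled j)"
    proof
      assume "F \<subseteq> cells lam"
      then show "finite F \<and> (\<forall>(p, y)\<in>F\<inverse>. y \<le> ?H p)"
        using finite_subset[OF _ finite_cells] by (auto simp: cells_col_height[OF lam])
    next
      assume F: "finite F \<and> (\<forall>(p, y)\<in>F\<inverse>. y \<le> ?H p)"
      show "F \<subseteq> cells lam"
      proof clarify
        fix p y assume py: "(p, y) \<in> F"
        have "finite {j. (p, j) \<in> F}" "finite {i. (i, y) \<in> F}"
          using F by (simp_all add: finite_sections)
        with py have "card {j. (p, j) \<in> F} \<noteq> 0" "card {i. (i, y) \<in> F} \<noteq> 0" by auto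
        then have "row_mult p \<noteq> 0" "y \<noteq> 0" using row col by (metis, metis)
        then show "(p, y) \<in> cells lam"
          using F py by (auto simp: cells_col_height[OF lam] row_mult_def split: if_splits)
      qed
    qed
    have "count_list columns j = (if j = 0 then 0 else column_filled j)"
      "(if i = 0 then 0 else row_mult i) = row_mult i" for i j
      by (auto simp: count_columns column_filled_def row_mult_def)
    then have *: "(\<forall>j. card {i. (j, i) \<in> F\<inverse>} = count_list columns j) \<longleftrightarrow>
        (\<forall>j. card {i. (i, j) \<in> F} = (if j = 0 then 0 else column_filled j))"
      "(\<forall>i. card {j. (j, i) \<in> F\<inverse>} = (if i = 0 then 0 else row_mult i)) \<longleftrightarrow>
        (\<forall>i. card {j. (i, j) \<in> F} = row_mult i)"
      by simp_all
    have pattern: "(\<forall>x\<in>{[3, 1, 2], [2, 1, 2]}. \<not> contains_word lam F x) \<longleftrightarrow> pattern_free ?H (F\<inverse>)"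
      if "filling F"
      by (rule avoids_312_212[OF lam _ filling_column_unique[OF that]])
         (use that in \<open>simp add: filling_def\<close>)
    have combine: "(S \<and> C \<and> R) \<and> A \<longleftrightarrow> N \<and> C \<and> B \<and> R \<and> P"
      if "R \<Longrightarrow> C \<Longrightarrow> S = (N \<and> B)" "S \<and> C \<and> R \<Longrightarrow> A = P" for S C R A N B P
      using that by blast
    show ?thesis
      unfolding W_eq placements_def mem_Collect_eq filling_def * finite_converse
      by (rule combine[OF cells pattern[unfolded filling_def]])
  qed
  have "placements ?H columns row_mult = converse ` W lam a {[3, 1, 2], [2, 1, 2]}"
  proof (intro equalityI subsetI)
    fix G assume "G \<in> placements ?H columns row_mult"
    then have "G\<inverse> \<in> W lam a {[3, 1, 2], [2, 1, 2]}" unfolding W_iff by simp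
    then show "G \<in> converse ` W lam a {[3, 1, 2], [2, 1, 2]}"
      by (rule image_eqI[rotated]) simp
  next
    fix G assume "G \<in> converse ` W lam a {[3, 1, 2], [2, 1, 2]}"
    then show "G \<in> placements ?H columns row_mult" using W_iff by blast
  qed
  moreover have "inj_on converse (W lam a {[3, 1, 2], [2, 1, 2]})"
    by (intro inj_onI) simp
  ultimately have "card (W lam a {[3, 1, 2], [2, 1, 2]}) = card (placements ?H columns row_mult)"
    by (simp add: card_image)
  moreover have strict: "sorted_wrt (>) columns"
    by (simp add: columns_def sorted_wrt_rev del: upt_Suc)
  moreover have "sorted_wrt (\<ge>) columns"
    using strict by (rule sorted_wrt_mono_rel[rotated]) simp
  moreover have "heights 0 (row_events rows) = marks ?H columns"
    unfolding heights_row_events[OF sorted_rows] marks_strict[OF strict]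
    unfolding rows_simps columns_def by simp
  moreover have "content 0 (row_events rows) y = row_mult y" if "y > 0" for y
    using that le by (auto simp: content_row_events rows_simps row_mult_def)
  ultimately show ?thesis using card_placements[of columns "row_events rows" ?H row_mult] by simp
qed

end

text \<open>A positive number of ones is prescribed for row \<open>length a\<close>, which has no
  cells.\<close>

lemma W_empty_if_too_many_rows:
  assumes "length lam < length a" "\<forall>k\<in>set a. 0 < k"
  shows "W lam a \<Omega> = {}"
proof -
  have "{j. (length a, j) \<in> F} = {}" if "F \<subseteq> cells lam" for F
    using that assms(1) by (auto simp: cells_def)
  moreover have "a ! (length a - 1) > 0" "1 \<le> length a"
    using assms by (auto simp: Suc_le_eq)
  ultimately show ?thesis unfolding W_def by (auto intro!: exI[of _ "length a"])
qed

theorem theorem14: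
  fixes lam a :: "nat list"
  assumes "ferrers lam"
    and "\<forall>k \<in> set a. 0 < k"
  shows "card (W lam a {[2,3,1], [2,2,1]}) = card (W lam a {[3,1,2], [2,1,2]})"
proof (cases "length a \<le> length lam")
  case True
  then show ?thesis
    using card_W_231_221[OF assms(1) True] card_W_312_212[OF assms(1) True] walk_events by simp
next
  case False
  then show ?thesis using assms(2) by (simp add: W_empty_if_too_many_rows)
qed

end
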